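(* Let $\ell\ge 2$ and $2\le k\le \ell$. Then the cone $\mathbf{c}\mathcal{A}_{\ell}^{k}$ is free with exponents $\{0,1,\ell,\ell,\dots,\ell\}$, where $\ell$ appears $\ell-1$ times. Moreover, if $\ell\ge 3$, then $\mathbf{c}\mathcal{A}_{\ell}^{k}$ is not supersolvable except when $k=\ell$.
   Context: For $2\le k\le \ell$, the $(k,\ell)$-Shi-Ish arrangement $\mathcal{A}_{\ell}^{k}$ is the arrangement of affine hyperplanes in $\mathbb{R}^{\ell}$ consisting of $x_i-x_j=0$ for $1\le i<j\le \ell$; $x_1-x_j=i$ for $1\le i<j\le \ell$ with $i<k$; $x_i-x_j=1$ for $k\le i<j\le \ell$. (For $k=2$ this is the Shi arrangement, for $k=\ell$ the Ish arrangement.) For an arrangement $\mathcal{A}$ in $\mathbb{R}^\ell$ with hyperplanes $H=\ker\alpha_H$, $\alpha_H=a_1x_1+\dots+a_\ell x_\ell+d$, the cone $\mathbf{c}\mathcal{A}$ is the central arrangement in $\mathbb{R}^{\ell+1}$ (coordinates $x_1,\dots,x_\ell,z$) consisting of $z=0$ together with the hyperplanes $a_1x_1+\dots+a_\ell x_\ell+dz=0$ for $H\in\mathcal{A}$. A central arrangement $\mathcal{A}$ in $\mathbb{R}^n$ with $S=\mathbb{R}[x_1,\dots,x_n]$ is free with exponents $\{d_1,\dots,d_n\}$ if the module $D(\mathcal{A})=\{\theta\in \mathrm{Der}_{\mathbb{R}}(S): \theta(\alpha_H)\in\alpha_H S \text{ for all } H\in\mathcal{A}\}$ is a free $S$-module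 with a homogeneous basis of polynomial degrees $d_1,\dots,d_n$. For a central arrangement $\mathcal{A}$, its intersection lattice $L(\mathcal{A})$ is the set of all intersections of subsets of $\mathcal{A}$ ordered by reverse inclusion; $X\in L(\mathcal{A})$ is modular if $X+Y\in L(\mathcal{A})$ for all $Y\in L(\mathcal{A})$; $\mathcal{A}$ is supersolvable if $L(\mathcal{A})$ has a maximal chain consisting of modular elements. *)

theory Defs
  imports
    Complex_Main
    "HOL-Library.Poly_Mapping"
    "HOL-Library.FuncSet"
    "HOL-Library.Multiset"
    "Jordan_Normal_Form.Matrix"
begin

section \<open>Arrangements and cones\<close>

text \<open>The space \<open>\<real>\<^sup>n\<close> is \<^term>\<open>carrier_vec n\<close>, whose coordinates are indexed by \<open>0, \<dots>, n - 1\<close>: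
  the coordinate \<open>x\<^sub>i\<close> of the literature (\<open>1 \<le> i \<le> n\<close>) is \<open>x $ (i - 1)\<close>.
  An arrangement in \<open>\<real>\<^sup>n\<close> is a set of hyperplanes, each of them a set of points.\<close>

type_synonym arrangement = "real vec set set"

definition hyperplane :: "nat \<Rightarrow> real vec \<Rightarrow> real \<Rightarrow> real vec set" where
  "hyperplane n a d = {x \<in> carrier_vec n. scalar_prod a x + d = 0}"

definition diff_hyperplane :: "nat \<Rightarrow> nat \<Rightarrow> nat \<Rightarrow> real \<Rightarrow> real vec set" where
  "diff_hyperplane n i j c = {x \<in> carrier_vec n. x $ (i - 1) - x $ (j - 1) = c}"

definition shi_ish :: "nat \<Rightarrow> nat \<Rightarrow> arrangement" where
  "shi_ish l k =
     {diff_hyperplane l i j 0 | i j. 1 \<le> i \<and> i < j \<and> j \<le> l} \<union>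
     {diff_hyperplane l 1 j (real i) | i j. 1 \<le> i \<and> i < j \<and> j \<le> l \<and> i < k} \<union>
     {diff_hyperplane l i j 1 | i j. k \<le> i \<and> i < j \<and> j \<le> l}"

text \<open>The homogenizing coordinate \<open>z\<close> is the last one, with index \<open>n\<close>. All defining equations
  \<open>(a, d)\<close> of a hyperplane are proportional, so they all give the same hyperplane of the cone.\<close>

definition cone_arrangement :: "nat \<Rightarrow> arrangement \<Rightarrow> arrangement" where
  "cone_arrangement n A =
     insert {x \<in> carrier_vec (n + 1). x $ n = 0}
       {hyperplane (n + 1) (a @\<^sub>v vec 1 (\<lambda>_. d)) 0 | a d.
          a \<in> carrier_vec n \<and> a \<noteq> 0\<^sub>v n \<and> hyperplane n a d \<in> A}"


section \<open>Logarithmic derivations and freeness\<close>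

text \<open>Polynomials in the variables \<open>x\<^sub>0, x\<^sub>1, \<dots>\<close>: a finitely supported map from monomials
  (finitely supported exponent functions) to coefficients. The ring
  \<open>\<real>[x\<^sub>0, \<dots>, x\<^sub>n\<^sub>-\<^sub>1]\<close> is the subring \<open>poly_ring n\<close>.\<close>

type_synonym real_mpoly = "(nat \<Rightarrow>\<^sub>0 nat) \<Rightarrow>\<^sub>0 real"

definition const_poly :: "real \<Rightarrow> real_mpoly" where
  "const_poly c = Poly_Mapping.single 0 c"

definition var_poly :: "nat \<Rightarrow> real_mpoly" where
  "var_poly i = Poly_Mapping.single (Poly_Mapping.single i 1) 1"

definition poly_ring :: "nat \<Rightarrow> real_mpoly set" where
  "poly_ring n = {p. \<forall>m \<in> Poly_Mapping.keys p. Poly_Mapping.keys m \<subseteq> {..<n}}"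

definition homogeneous_poly :: "nat \<Rightarrow> real_mpoly \<Rightarrow> bool" where
  "homogeneous_poly d p \<longleftrightarrow>
     (\<forall>m \<in> Poly_Mapping.keys p. (\<Sum>i \<in> Poly_Mapping.keys m. Poly_Mapping.lookup m i) = d)"

definition linear_form :: "nat \<Rightarrow> real vec \<Rightarrow> real_mpoly" where
  "linear_form n a = (\<Sum>i<n. const_poly (a $ i) * var_poly i)"

text \<open>\<open>\<real>\<close>-linear derivations of \<open>poly_ring n\<close>; maps are extensional, so that equality of
  derivations is equality on \<open>poly_ring n\<close>.\<close>

definition derivations :: "nat \<Rightarrow> (real_mpoly \<Rightarrow> real_mpoly) set" where
  "derivations n = {\<theta> \<in> poly_ring n \<rightarrow>\<^sub>E poly_ring n.
     (\<forall>p \<in> poly_ring n. \<forall>q \<in> poly_ring n. \<theta> (p + q) = \<theta> p + \<theta> q) \<and>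
     (\<forall>c. \<forall>p \<in> poly_ring n. \<theta> (const_poly c * p) = const_poly c * \<theta> p) \<and>
     (\<forall>p \<in> poly_ring n. \<forall>q \<in> poly_ring n. \<theta> (p * q) = p * \<theta> q + q * \<theta> p)}"

text \<open>The condition does not depend on which linear form \<open>a\<close> with kernel \<open>H\<close> is used, so it is
  imposed for all of them.\<close>

definition log_derivations :: "nat \<Rightarrow> arrangement \<Rightarrow> (real_mpoly \<Rightarrow> real_mpoly) set" where
  "log_derivations n A = {\<theta> \<in> derivations n.
     \<forall>H \<in> A. \<forall>a \<in> carrier_vec n. a \<noteq> 0\<^sub>v n \<and> H = hyperplane n a 0 \<longrightarrow>
       (\<exists>g \<in> poly_ring n. \<theta> (linear_form n a) = linear_form n a * g)}"

definition homogeneous_derivation :: "nat \<Rightarrow> nat \<Rightarrow> (real_mpoly \<Rightarrow> real_mpoly) \<Rightarrow> bool" where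
  "homogeneous_derivation n d \<theta> \<longleftrightarrow> (\<forall>i<n. homogeneous_poly d (\<theta> (var_poly i)))"

definition module_basis ::
  "nat \<Rightarrow> (real_mpoly \<Rightarrow> real_mpoly) set \<Rightarrow> (real_mpoly \<Rightarrow> real_mpoly) list \<Rightarrow> bool" where
  "module_basis n M \<theta>s \<longleftrightarrow>
     set \<theta>s \<subseteq> M \<and>
     (\<forall>\<theta> \<in> M. \<exists>f \<in> {..<length \<theta>s} \<rightarrow> poly_ring n.
        \<forall>p \<in> poly_ring n. \<theta> p = (\<Sum>i<length \<theta>s. f i * (\<theta>s ! i) p)) \<and>
     (\<forall>f \<in> {..<length \<theta>s} \<rightarrow> poly_ring n.
        (\<forall>p \<in> poly_ring n. (\<Sum>i<length \<theta>s. f i * (\<theta>s ! i) p) = 0) \<longrightarrow>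
        (\<forall>i<length \<theta>s. f i = 0))"

definition free_with_exponents :: "nat \<Rightarrow> arrangement \<Rightarrow> nat multiset \<Rightarrow> bool" where
  "free_with_exponents n A E \<longleftrightarrow>
     (\<exists>\<theta>s ds. length \<theta>s = n \<and> length ds = n \<and> mset ds = E \<and>
        module_basis n (log_derivations n A) \<theta>s \<and>
        (\<forall>i<n. homogeneous_derivation n (ds ! i) (\<theta>s ! i)))"


section \<open>Supersolvability\<close>

text \<open>The empty intersection is the whole space \<^term>\<open>carrier_vec n\<close>.\<close>

definition intersection_lattice :: "nat \<Rightarrow> arrangement \<Rightarrow> real vec set set" where
  "intersection_lattice n A = {carrier_vec n \<inter> \<Inter>B | B. B \<subseteq> A}"

definition modular_element :: "nat \<Rightarrow> arrangement \<Rightarrow> real vec set \<Rightarrow> bool" where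
  "modular_element n A X \<longleftrightarrow> X \<in> intersection_lattice n A \<and>
     (\<forall>Y \<in> intersection_lattice n A. {x + y | x y. x \<in> X \<and> y \<in> Y} \<in> intersection_lattice n A)"

definition supersolvable :: "nat \<Rightarrow> arrangement \<Rightarrow> bool" where
  "supersolvable n A \<longleftrightarrow>
     (\<exists>C. pred_on.maxchain (intersection_lattice n A) (\<lambda>X Y. Y \<subset> X) C \<and>
        (\<forall>X \<in> C. modular_element n A X))"

end

theory Submission
  imports Defs "Jordan_Normal_Form.Determinant"
begin

text \<open>Freeness. Write \<open>y\<^sub>j = x\<^sub>0 - x\<^sub>j\<close>, with coordinates counted from 0. Besides \<open>\<Sum> \<partial>\<^sub>i\<close> and the Euler
  derivation, the basis consists of derivations \<open>x\<^sub>j \<mapsto> F\<^sub>m(y\<^sub>j)\<close>, \<open>z \<mapsto> 0\<close> with univariate polynomials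
  \<open>F\<^sub>m\<close>, \<open>1 \<le> m < l\<close>, so the conditions along \<open>x\<^sub>i = x\<^sub>j\<close> hold automatically. For \<open>m + 1 < k\<close> take
  \<open>F\<^sub>m(t) = t (t - z) \<dots> (t - m z) \<Prod>\<^sub>p\<^sub>>\<^sub>m (t - y\<^sub>p)\<close>. For \<open>m + 1 \<ge> k\<close> let \<open>F\<^sub>m(0) = 0\<close> and let
  \<open>F\<^sub>m(t + z) - F\<^sub>m(t)\<close> be \<open>z\<close> times the product of \<open>t - i z\<close> (\<open>i < k - 1\<close>), \<open>t - y\<^sub>p\<close> (\<open>k - 1 \<le> p < m\<close>)
  and \<open>t + z - y\<^sub>p\<close> (\<open>p > m\<close>). The determinant of \<open>F\<^sub>m(y\<^sub>j)\<close> is divisible by the product of the defining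
  forms and has the same degree; it is nonzero because a linear combination of the \<open>F\<^sub>m\<close>, \<open>m + 1 \<ge> k\<close>,
  vanishing at all \<open>y\<^sub>p\<close>, \<open>p \<ge> k - 1\<close>, has \<open>l + 1\<close> roots but degree at most \<open>l\<close>.

  Supersolvability. For \<open>k = l\<close> the flag \<open>z = 0\<close>, \<open>z = y\<^sub>l\<^sub>-\<^sub>1 = 0\<close>, \<open>z = y\<^sub>l\<^sub>-\<^sub>1 = y\<^sub>l\<^sub>-\<^sub>2 = 0\<close>, and so on, is modular.
  For \<open>k < l\<close> a maximal chain of modular elements would induce a modular element of rank 2 in the
  localization at \<open>z = y\<^sub>k\<^sub>-\<^sub>1 = y\<^sub>l\<^sub>-\<^sub>1 = 0\<close>, and this rank-3 arrangement has none.\<close>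


section \<open>Polynomial substitution\<close>

abbreviation "lookup \<equiv> Poly_Mapping.lookup"
abbreviation "keys \<equiv> Poly_Mapping.keys"
abbreviation "single \<equiv> Poly_Mapping.single"

definition eval_monom :: "(nat \<Rightarrow> 'a::comm_ring_1) \<Rightarrow> (nat \<Rightarrow>\<^sub>0 nat) \<Rightarrow> 'a" where
  "eval_monom s m = (\<Prod>i\<in>keys m. s i ^ lookup m i)"

text \<open>The coefficient map \<open>h\<close> is left free so that one construction yields
  substitution of polynomials, evaluation at real points and the Taylor expansion with values in a
  polynomial ring.\<close>

definition eval_mpoly :: "(real \<Rightarrow> 'a) \<Rightarrow> (nat \<Rightarrow> 'a) \<Rightarrow> real_mpoly \<Rightarrow> 'a::comm_ring_1" where
  "eval_mpoly h s p = (\<Sum>m\<in>keys p. h (lookup p m) * eval_monom s m)"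

lemma eval_monom_superset:
  assumes "finite K" "keys m \<subseteq> K"
  shows "eval_monom s m = (\<Prod>i\<in>K. s i ^ lookup m i)"
  unfolding eval_monom_def
  by (rule prod.mono_neutral_left) (use assms in \<open>auto simp: in_keys_iff\<close>)

lemma eval_monom_zero [simp]: "eval_monom s 0 = 1"
  by (simp add: eval_monom_def)

lemma eval_monom_single [simp]: "eval_monom s (single i e) = s i ^ e"
  by (simp add: eval_monom_def)

lemma eval_monom_add: "eval_monom s (m + m') = eval_monom s m * eval_monom s m'"
proof -
  let ?K = "keys m \<union> keys m'"
  have "eval_monom s (m + m') = (\<Prod>i\<in>?K. s i ^ lookup (m + m') i)"
    by (rule eval_monom_superset) (use keys_add[of m m'] in auto)
  also have "\<dots> = (\<Prod>i\<in>?K. s i ^ lookup m i) * (\<Prod>i\<in>?K. s i ^ lookup m' i)"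
    by (simp add: lookup_add power_add prod.distrib)
  also have "\<dots> = eval_monom s m * eval_monom s m'"
    by (simp add: eval_monom_superset[where K = ?K])
  finally show ?thesis .
qed

lemma poly_mapping_eq_sum_single:
  fixes p :: "'a \<Rightarrow>\<^sub>0 'b::comm_monoid_add"
  shows "p = (\<Sum>m\<in>keys p. single m (lookup p m))"
proof (rule poly_mapping_eqI)
  fix k
  have "(\<Sum>m\<in>keys p. lookup (single m (lookup p m)) k) = (\<Sum>m\<in>keys p. if m = k then lookup p k else 0)"
    by (rule sum.cong) (auto simp: lookup_single when_def)
  also have "\<dots> = lookup p k"
    by (simp add: in_keys_iff)
  finally show "lookup p k = lookup (\<Sum>m\<in>keys p. single m (lookup p m)) k"
    by (simp add: lookup_sum)
qed

lemma poly_mapping_single_induct: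
  fixes p :: "'a \<Rightarrow>\<^sub>0 'b::comm_monoid_add"
  assumes "\<And>m c. m \<in> keys p \<Longrightarrow> P (single m c)" and "P 0"
    and "\<And>p q. P p \<Longrightarrow> P q \<Longrightarrow> P (p + q)"
  shows "P p"
proof -
  have "P (\<Sum>m\<in>K. single m (lookup p m))" if "finite K" "K \<subseteq> keys p" for K
    using that by (induction K) (auto intro: assms)
  then show ?thesis
    by (subst poly_mapping_eq_sum_single) simp
qed

lemma const_poly_simps [simp]:
  "const_poly 0 = 0" "const_poly 1 = 1"
  "const_poly (a + b) = const_poly a + const_poly b"
  "const_poly (a * b) = const_poly a * const_poly b"
  "const_poly (- a) = - const_poly a"
  "const_poly (a - b) = const_poly a - const_poly b"
  by (simp_all add: const_poly_def single_add mult_single single_uminus single_diff)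

lemma const_poly_power: "const_poly (a ^ n) = const_poly a ^ n"
  by (induction n) simp_all

lemma const_poly_eq_0_iff [simp]: "const_poly c = 0 \<longleftrightarrow> c = 0"
  by (metis const_poly_def const_poly_simps(1) lookup_single_eq lookup_zero)

lemma const_poly_hom: "comm_ring_hom const_poly"
  by unfold_locales simp_all

context
  fixes h :: "real \<Rightarrow> 'a::comm_ring_1"
  assumes h: "comm_ring_hom h"
begin

interpretation h: comm_ring_hom h by (rule h)

lemma eval_mpoly_single: "eval_mpoly h s (single m c) = h c * eval_monom s m"
  by (cases "c = 0") (simp_all add: eval_mpoly_def h.hom_zero)

lemma eval_mpoly_const: "eval_mpoly h s (const_poly c) = h c"
  by (simp add: const_poly_def eval_mpoly_single)

lemma eval_mpoly_var: "eval_mpoly h s (var_poly i) = s i"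
  by (simp add: var_poly_def eval_mpoly_single h.hom_one)

lemma eval_mpoly_add: "eval_mpoly h s (p + q) = eval_mpoly h s p + eval_mpoly h s q"
  unfolding eval_mpoly_def
  by (rule setsum_keys_plus_distrib) (simp_all add: h.hom_zero h.hom_add algebra_simps)

lemma eval_mpoly_zero: "eval_mpoly h s 0 = 0"
  by (simp add: eval_mpoly_def)

lemma eval_mpoly_mult: "eval_mpoly h s (p * q) = eval_mpoly h s p * eval_mpoly h s q"
proof (induction p rule: poly_mapping_single_induct)
  case (1 m c)
  show ?case
  proof (induction q rule: poly_mapping_single_induct)
    case (1 m' c')
    show ?case
      by (simp add: mult_single eval_mpoly_single eval_monom_add h.hom_mult algebra_simps)
  qed (simp_all add: eval_mpoly_zero eval_mpoly_add algebra_simps)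
qed (simp_all add: eval_mpoly_zero eval_mpoly_add algebra_simps)

lemma eval_mpoly_hom: "comm_ring_hom (eval_mpoly h s)"
  by unfold_locales
    (auto simp: eval_mpoly_zero eval_mpoly_add eval_mpoly_mult h.hom_one
       eval_mpoly_const[where c = 1, simplified])

end

lemma var_power: "var_poly i ^ e = single (single i e) 1"
  by (induction e) (simp_all add: var_poly_def mult_single single_add[symmetric])

lemma eval_monom_var: "eval_monom var_poly m = single m 1"
proof -
  have "(\<Prod>i\<in>K. var_poly i ^ lookup m i) = single (\<Sum>i\<in>K. single i (lookup m i)) 1" if "finite K" for K
    using that by (induction K) (simp_all add: var_power mult_single)
  then show ?thesis
    unfolding eval_monom_def by (subst (3) poly_mapping_eq_sum_single) simp
qed

abbreviation subst_mpoly :: "(nat \<Rightarrow> real_mpoly) \<Rightarrow> real_mpoly \<Rightarrow> real_mpoly" where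
  "subst_mpoly \<equiv> eval_mpoly const_poly"

lemma single_eq_const_times: "single m c = const_poly c * eval_monom var_poly m"
  by (simp add: eval_monom_var const_poly_def mult_single)

section \<open>The subring \<open>poly_ring n\<close>: closure, induction and retraction\<close>

lemma poly_ring_const [simp]: "const_poly c \<in> poly_ring n"
  by (simp add: poly_ring_def const_poly_def)

lemma poly_ring_var [simp]: "i < n \<Longrightarrow> var_poly i \<in> poly_ring n"
  by (simp add: poly_ring_def var_poly_def)

lemma poly_ring_zero [simp]: "0 \<in> poly_ring n"
  by (simp add: poly_ring_def)

lemma poly_ring_one [simp]: "1 \<in> poly_ring n"
  using poly_ring_const[of 1 n] by simp

lemma poly_ring_add [simp]: "p \<in> poly_ring n \<Longrightarrow> q \<in> poly_ring n \<Longrightarrow> p + q \<in> poly_ring n"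
  using keys_add[of p q] by (auto simp: poly_ring_def)

lemma poly_ring_mult [simp]: "p \<in> poly_ring n \<Longrightarrow> q \<in> poly_ring n \<Longrightarrow> p * q \<in> poly_ring n"
proof -
  assume pq: "p \<in> poly_ring n" "q \<in> poly_ring n"
  have "keys m \<subseteq> {..<n}" if m: "m \<in> keys (p * q)" for m
  proof -
    obtain a b where "m = a + b" "a \<in> keys p" "b \<in> keys q"
      using m keys_mult[of p q] by blast
    then show ?thesis
      using pq keys_add[of a b] unfolding poly_ring_def by blast
  qed
  then show ?thesis
    by (simp add: poly_ring_def)
qed

lemma poly_ring_uminus [simp]: "p \<in> poly_ring n \<Longrightarrow> - p \<in> poly_ring n"
  by (simp add: poly_ring_def)

lemma poly_ring_diff [simp]: "p \<in> poly_ring n \<Longrightarrow> q \<in> poly_ring n \<Longrightarrow> p - q \<in> poly_ring n"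
  using poly_ring_add[of p n "- q"] by simp

lemma poly_ring_sum: "(\<And>i. i \<in> S \<Longrightarrow> f i \<in> poly_ring n) \<Longrightarrow> sum f S \<in> poly_ring n"
  by (induction S rule: infinite_finite_induct) auto

lemma poly_ring_prod: "(\<And>i. i \<in> S \<Longrightarrow> f i \<in> poly_ring n) \<Longrightarrow> prod f S \<in> poly_ring n"
  by (induction S rule: infinite_finite_induct) auto

lemma poly_ring_induct [consumes 1, case_names const var add mult]:
  assumes "p \<in> poly_ring n"
    and const: "\<And>c. P (const_poly c)" and var: "\<And>i. i < n \<Longrightarrow> P (var_poly i)"
    and add: "\<And>p q. p \<in> poly_ring n \<Longrightarrow> q \<in> poly_ring n \<Longrightarrow> P p \<Longrightarrow> P q \<Longrightarrow> P (p + q)"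
    and mult: "\<And>p q. p \<in> poly_ring n \<Longrightarrow> q \<in> poly_ring n \<Longrightarrow> P p \<Longrightarrow> P q \<Longrightarrow> P (p * q)"
  shows "P p"
proof -
  let ?P = "\<lambda>p. p \<in> poly_ring n \<and> P p"
  have pow: "?P (var_poly i ^ e)" if "i < n" for i e
    using that const[of 1] by (induction e) (auto intro: mult var)
  have monom: "?P (eval_monom var_poly m)" if "keys m \<subseteq> {..<n}" for m
  proof -
    have "?P (\<Prod>i\<in>K. var_poly i ^ lookup m i)" if "finite K" "K \<subseteq> {..<n}" for K
      using that
    proof (induction K)
      case empty
      then show ?case using const[of 1] by simp
    next
      case (insert i K)
      then show ?case using pow[of i "lookup m i"] by (auto intro: mult)
    qed
    then show ?thesis
      using that unfolding eval_monom_def by auto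
  qed
  have "?P p"
  proof (induction p rule: poly_mapping_single_induct)
    case (1 m c)
    then have "keys m \<subseteq> {..<n}"
      using assms(1) by (auto simp: poly_ring_def)
    then show ?case
      unfolding single_eq_const_times using monom[of m] by (auto intro: mult const)
  qed (use const[of 0] in \<open>auto intro: add\<close>)
  then show ?thesis ..
qed

lemma ex_poly_ring: "\<exists>n. p \<in> poly_ring n"
proof -
  have "finite (\<Union>m\<in>keys p. keys m)"
    by auto
  then obtain n where "(\<Union>m\<in>keys p. keys m) \<subseteq> {..<n}"
    using finite_nat_iff_bounded by blast
  then show ?thesis
    unfolding poly_ring_def by blast
qed

lemma mpoly_induct [case_names const var add mult]:
  assumes "\<And>c. P (const_poly c)" and "\<And>i. P (var_poly i)"
    and "\<And>p q. P p \<Longrightarrow> P q \<Longrightarrow> P (p + q)" and "\<And>p q. P p \<Longrightarrow> P q \<Longrightarrow> P (p * q)"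
  shows "P p"
proof -
  obtain n where "p \<in> poly_ring n"
    using ex_poly_ring by blast
  then show ?thesis
    by (induction p rule: poly_ring_induct) (auto intro: assms)
qed

lemmas subst_mpoly_hom = eval_mpoly_hom[OF const_poly_hom]
lemma subst_mpoly_simps:
  "subst_mpoly s (const_poly c) = const_poly c" "subst_mpoly s (var_poly i) = s i"
  "subst_mpoly s 0 = 0" "subst_mpoly s 1 = 1"
  "subst_mpoly s (p + q) = subst_mpoly s p + subst_mpoly s q"
  "subst_mpoly s (p - q) = subst_mpoly s p - subst_mpoly s q"
  "subst_mpoly s (- p) = - subst_mpoly s p"
  "subst_mpoly s (p * q) = subst_mpoly s p * subst_mpoly s q"
proof -
  interpret comm_ring_hom "subst_mpoly s"
    by (rule subst_mpoly_hom)
  show "subst_mpoly s 0 = 0" "subst_mpoly s 1 = 1"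
    "subst_mpoly s (p + q) = subst_mpoly s p + subst_mpoly s q"
    "subst_mpoly s (p - q) = subst_mpoly s p - subst_mpoly s q"
    "subst_mpoly s (- p) = - subst_mpoly s p"
    "subst_mpoly s (p * q) = subst_mpoly s p * subst_mpoly s q"
    by (simp_all add: hom_distribs)
qed (simp_all add: eval_mpoly_const[OF const_poly_hom] eval_mpoly_var[OF const_poly_hom])

text \<open>Modulo \<open>a\<close> the substitution fixes every variable, hence every polynomial.
  This turns divisibility by a linear form into vanishing under a substitution.\<close>

lemma dvd_diff_subst_mpoly:
  assumes "\<And>i. a dvd var_poly i - s i"
  shows "a dvd p - subst_mpoly s p"
proof (induction p rule: mpoly_induct)
  case (mult p q)
  have "p * q - subst_mpoly s (p * q) =
      (p - subst_mpoly s p) * q + subst_mpoly s p * (q - subst_mpoly s q)"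
    by (simp add: subst_mpoly_simps algebra_simps)
  then show ?case
    using mult by (metis dvd_add dvd_mult dvd_mult2)
next
  case (add p q)
  have "p + q - subst_mpoly s (p + q) = (p - subst_mpoly s p) + (q - subst_mpoly s q)"
    by (simp add: subst_mpoly_simps algebra_simps)
  then show ?case
    using add by (metis dvd_add)
qed (use assms in \<open>simp_all add: subst_mpoly_simps\<close>)

text \<open>Killing the variables with index at least \<open>n\<close> retracts the polynomial type onto
  \<open>poly_ring n\<close>, so divisibility in the type and in the subring agree.\<close>

lemma poly_ring_dvdE:
  assumes "a dvd p" "a \<in> poly_ring n" "p \<in> poly_ring n"
  obtains g where "g \<in> poly_ring n" "p = a * g"
proof -
  let ?r = "subst_mpoly (\<lambda>i. if i < n then var_poly i else 0)"
  have in_ring: "?r q \<in> poly_ring n" for q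
    by (induction q rule: mpoly_induct) (simp_all add: subst_mpoly_simps)
  have fixed: "?r q = q" if "q \<in> poly_ring n" for q
    using that by (induction q rule: poly_ring_induct) (simp_all add: subst_mpoly_simps)
  obtain q where "p = a * q"
    using assms(1) by (rule dvdE)
  then have "?r p = ?r a * ?r q"
    by (simp add: subst_mpoly_simps)
  then have "p = a * ?r q"
    using assms(2,3) by (simp add: fixed)
  then show ?thesis
    by (rule that[OF in_ring])
qed

section \<open>Homogeneity as an eigenvalue condition\<close>

abbreviation double_vars :: "real_mpoly \<Rightarrow> real_mpoly" where
  "double_vars \<equiv> subst_mpoly (\<lambda>i. const_poly 2 * var_poly i)"

lemma lookup_double_vars: "lookup (double_vars p) m = 2 ^ (\<Sum>i\<in>keys m. lookup m i) * lookup p m"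
proof -
  have mono: "eval_monom (\<lambda>i. const_poly 2 * var_poly i) m =
      const_poly (2 ^ (\<Sum>i\<in>keys m. lookup m i)) * eval_monom var_poly m" for m
    unfolding const_poly_power unfolding eval_monom_def power_mult_distrib prod.distrib power_sum ..
  have "double_vars p = (\<Sum>m\<in>keys p. single m (2 ^ (\<Sum>i\<in>keys m. lookup m i) * lookup p m))"
    unfolding eval_mpoly_def mono single_eq_const_times const_poly_simps(4)
    by (intro sum.cong refl) (simp only: mult_ac)
  then have "lookup (double_vars p) m =
      (\<Sum>m'\<in>keys p. if m' = m then 2 ^ (\<Sum>i\<in>keys m. lookup m i) * lookup p m else 0)"
    by (simp only: lookup_sum) (rule sum.cong, auto simp: lookup_single when_def)
  then show ?thesis
    by (simp add: in_keys_iff)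
qed

text \<open>Doubling all variables multiplies a monomial of degree e by 2^e, and these eigenvalues
  differ for different degrees. Homogeneity thus becomes an equation compatible with sums, products
  and determinants.\<close>

lemma homogeneous_poly_if_double_vars:
  assumes "double_vars p = const_poly 2 ^ d * p"
  shows "homogeneous_poly d p"
  unfolding homogeneous_poly_def
proof
  fix m assume m: "m \<in> keys p"
  have "lookup (const_poly c * p) m = c * lookup p m" for c
    unfolding const_poly_def mult_map_scale_conv_mult[symmetric]
    by (simp add: Poly_Mapping.map.rep_eq when_def)
  then have "2 ^ (\<Sum>i\<in>keys m. lookup m i) * lookup p m = 2 ^ d * lookup p m"
    using assms lookup_double_vars[of p m] by (metis const_poly_power)
  then show "(\<Sum>i\<in>keys m. lookup m i) = d"
    using m by (simp add: in_keys_iff)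
qed

text \<open>Serves to identify the quotient of the coefficient determinant by the product of the
  defining forms once their degrees agree.\<close>

lemma double_vars_fixed_imp_const:
  assumes "double_vars p = p"
  obtains c where "p = const_poly c"
proof -
  have "homogeneous_poly 0 p"
    using assms by (intro homogeneous_poly_if_double_vars) simp
  have "lookup p m = 0" if "m \<noteq> 0" for m
  proof (rule ccontr)
    assume "lookup p m \<noteq> 0"
    then have "m \<in> keys p"
      by (simp add: in_keys_iff)
    then have "\<forall>i\<in>keys m. lookup m i = 0"
      using \<open>homogeneous_poly 0 p\<close> by (auto simp: homogeneous_poly_def)
    then have "keys m = {}"
      by (meson all_not_in_conv in_keys_iff)
    then show False
      using that by simp
  qed
  then have "p = const_poly (lookup p 0)"
    unfolding const_poly_def by (intro poly_mapping_eqI) (auto simp: lookup_single when_def)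
  then show ?thesis
    using that by blast
qed


section \<open>Derivations\<close>

text \<open>Unlike \<open>derivations n\<close>, this asks neither for extensionality nor for values
  in \<open>poly_ring n\<close>, so that combinations of derivations written as lambda terms satisfy
  it directly.\<close>

definition derivation_on :: "nat \<Rightarrow> (real_mpoly \<Rightarrow> real_mpoly) \<Rightarrow> bool" where
  "derivation_on n D \<longleftrightarrow> (\<forall>c. D (const_poly c) = 0) \<and>
     (\<forall>p\<in>poly_ring n. \<forall>q\<in>poly_ring n. D (p + q) = D p + D q) \<and>
     (\<forall>p\<in>poly_ring n. \<forall>q\<in>poly_ring n. D (p * q) = p * D q + q * D p)"

lemma derivation_on_unique:
  assumes "derivation_on n D" "derivation_on n D'" "\<And>i. i < n \<Longrightarrow> D (var_poly i) = D' (var_poly i)"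
    and "p \<in> poly_ring n"
  shows "D p = D' p"
  using assms(4)
proof (induction p rule: poly_ring_induct)
  case (add p q)
  then show ?case using assms(1,2) by (simp add: derivation_on_def)
next
  case (mult p q)
  then show ?case using assms(1,2) by (simp add: derivation_on_def)
qed (use assms in \<open>simp_all add: derivation_on_def\<close>)

lemma derivations_imp_derivation_on:
  assumes "\<theta> \<in> derivations n"
  shows "derivation_on n \<theta>"
proof -
  have "\<theta> (1 * 1) = 1 * \<theta> 1 + 1 * \<theta> 1"
    using assms poly_ring_one unfolding derivations_def by blast
  then have "\<theta> 1 = 0"
    by simp
  have "\<theta> (const_poly c * 1) = const_poly c * \<theta> 1" for c
    using assms poly_ring_one unfolding derivations_def by blast
  then have "\<theta> (const_poly c) = 0" for c
    by (simp add: \<open>\<theta> 1 = 0\<close>)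
  then show ?thesis
    using assms by (auto simp: derivations_def derivation_on_def)
qed

lemma derivation_on_sum:
  assumes "\<And>i. i \<in> S \<Longrightarrow> derivation_on n (D i)"
  shows "derivation_on n (\<lambda>p. \<Sum>i\<in>S. f i * D i p)"
  using assms unfolding derivation_on_def
  by (simp add: sum.distrib sum_distrib_left algebra_simps)

lemma derivations_closed: "\<theta> \<in> derivations n \<Longrightarrow> p \<in> poly_ring n \<Longrightarrow> \<theta> p \<in> poly_ring n"
  by (auto simp: derivations_def)

lemma linear_form_in_poly_ring [simp]: "linear_form n a \<in> poly_ring n"
  unfolding linear_form_def by (intro poly_ring_sum) auto

lemma derivation_linear_form:
  assumes "\<theta> \<in> derivations n"
  shows "\<theta> (linear_form n a) = (\<Sum>i<n. const_poly (a $ i) * \<theta> (var_poly i))"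
proof -
  have "\<theta> 0 = 0"
    using derivations_imp_derivation_on[OF assms] unfolding derivation_on_def
    by (metis const_poly_simps(1))
  have "\<theta> (\<Sum>i<k. const_poly (a $ i) * var_poly i) = (\<Sum>i<k. const_poly (a $ i) * \<theta> (var_poly i))"
    if "k \<le> n" for k
    using that
  proof (induction k)
    case (Suc k)
    have "(\<Sum>i<k. const_poly (a $ i) * var_poly i) \<in> poly_ring n"
      "const_poly (a $ k) * var_poly k \<in> poly_ring n" "var_poly k \<in> poly_ring n"
      using Suc.prems by (auto intro!: poly_ring_sum)
    then show ?case
      using Suc derivations_imp_derivation_on[OF assms] by (simp add: derivation_on_def)
  qed (simp add: \<open>\<theta> 0 = 0\<close>)
  then show ?thesis
    by (simp add: linear_form_def)
qed

text \<open>The homomorphism \<open>x\<^sub>i \<mapsto> x\<^sub>i + t f\<^sub>i\<close> into polynomials in \<open>t\<close> is the Taylor expansion along \<open>f\<close>,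
  whose coefficient at \<open>t\<close> is the derivation \<open>\<Sum> f\<^sub>i \<partial>\<^sub>i\<close>.\<close>

definition taylor :: "(nat \<Rightarrow> real_mpoly) \<Rightarrow> real_mpoly \<Rightarrow> real_mpoly poly" where
  "taylor f = eval_mpoly (\<lambda>c. [:const_poly c:]) (\<lambda>i. [:var_poly i, f i:])"

definition derivation_of :: "nat \<Rightarrow> (nat \<Rightarrow> real_mpoly) \<Rightarrow> real_mpoly \<Rightarrow> real_mpoly" where
  "derivation_of n f = (\<lambda>p\<in>poly_ring n. coeff (taylor f p) 1)"

lemma taylor_simps [simp]:
  "taylor f (const_poly c) = [:const_poly c:]" "taylor f (var_poly i) = [:var_poly i, f i:]"
  "taylor f (p + q) = taylor f p + taylor f q" "taylor f (p * q) = taylor f p * taylor f q"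
proof -
  have hom: "comm_ring_hom (\<lambda>c. [:const_poly c:])"
    by unfold_locales (simp_all add: one_pCons)
  show "taylor f (const_poly c) = [:const_poly c:]" "taylor f (var_poly i) = [:var_poly i, f i:]"
    "taylor f (p + q) = taylor f p + taylor f q" "taylor f (p * q) = taylor f p * taylor f q"
    unfolding taylor_def by (rule eval_mpoly_const[OF hom] eval_mpoly_var[OF hom]
      eval_mpoly_add[OF hom] eval_mpoly_mult[OF hom])+
qed

lemma taylor_coeff_0 [simp]: "coeff (taylor f p) 0 = p"
  by (induction p rule: mpoly_induct) (simp_all add: coeff_mult_0)

lemma coeff_mult_1: "coeff (p * q) 1 = coeff p 0 * coeff q 1 + coeff p 1 * coeff q 0"
  for p q :: "'a::comm_semiring_0 poly"
  by (simp add: coeff_mult)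

lemma derivation_of_var: "i < n \<Longrightarrow> derivation_of n f (var_poly i) = f i"
  by (simp add: derivation_of_def)

lemma derivation_of_in_derivations:
  assumes "\<And>i. i < n \<Longrightarrow> f i \<in> poly_ring n"
  shows "derivation_of n f \<in> derivations n"
proof -
  have closed: "coeff (taylor f p) 1 \<in> poly_ring n" if "p \<in> poly_ring n" for p
    using that
  proof (induction p rule: poly_ring_induct)
    case (mult p q)
    then show ?case
      by (simp only: taylor_simps coeff_mult_1 taylor_coeff_0) simp
  qed (use assms in simp_all)
  show ?thesis
    using closed unfolding derivations_def derivation_of_def
    by (simp add: coeff_mult_1[unfolded One_nat_def] algebra_simps)
qed


section \<open>The cone of the Shi-Ish arrangement\<close>

lemma scalar_prod_self_eq_0_iff:
  fixes v :: "real vec"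
  assumes "v \<in> carrier_vec n"
  shows "v \<bullet> v = 0 \<longleftrightarrow> v = 0\<^sub>v n"
proof -
  have "v \<bullet> v = (\<Sum>i\<in>{0..<n}. v $ i * v $ i)"
    using assms by (simp add: scalar_prod_def)
  then have "v \<bullet> v = 0 \<longleftrightarrow> (\<forall>i\<in>{0..<n}. v $ i * v $ i = 0)"
    by (simp add: sum_nonneg_eq_0_iff)
  also have "\<dots> \<longleftrightarrow> v = 0\<^sub>v n"
    using assms by auto
  finally show ?thesis .
qed

lemma hyperplane_eq_imp_proportional:
  assumes "a \<in> carrier_vec n" "b \<in> carrier_vec n" "b \<noteq> 0\<^sub>v n"
    and eq: "hyperplane n a d = hyperplane n b e"
  obtains s where "a = s \<cdot>\<^sub>v b" "d = s * e"
proof -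
  have bb: "b \<bullet> b \<noteq> 0"
    using assms scalar_prod_self_eq_0_iff by blast
  \<comment> \<open>The foot of the perpendicular from the origin to the hyperplane of
    \<open>b\<close>.\<close>
  define x where "x = (- e / (b \<bullet> b)) \<cdot>\<^sub>v b"
  have x: "x \<in> carrier_vec n" "b \<bullet> x = - e"
    using assms bb by (auto simp: x_def)
  then have "x \<in> hyperplane n a d"
    unfolding eq by (simp add: hyperplane_def)
  then have ax: "a \<bullet> x = - d"
    by (simp add: hyperplane_def)
  \<comment> \<open>\<open>v\<close> will be the component of \<open>a\<close> orthogonal to
    \<open>b\<close>. Translation by \<open>v\<close> preserves the common hyperplane, so
    \<open>a\<close>, and therefore \<open>v\<close> itself, is orthogonal to
    \<open>v\<close>.\<close>
  define s where "s = (a \<bullet> b) / (b \<bullet> b)"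
  define v where "v = a - s \<cdot>\<^sub>v b"
  have v: "v \<in> carrier_vec n"
    using assms by (simp add: v_def)
  have bv: "b \<bullet> v = 0"
    using assms bb by (simp add: v_def s_def scalar_prod_minus_distrib[of _ n] comm_scalar_prod[of a n b])
  then have "x + v \<in> hyperplane n a d"
    unfolding eq using x v assms by (simp add: hyperplane_def scalar_prod_add_distrib[of _ n])
  then have av: "a \<bullet> v = 0"
    using ax x v assms by (simp add: hyperplane_def scalar_prod_add_distrib[of _ n])
  have "v \<bullet> v = a \<bullet> v - s * (b \<bullet> v)"
    using v assms by (subst v_def) (simp add: minus_scalar_prod_distrib[of _ n])
  then have "v = 0\<^sub>v n"
    using av bv v scalar_prod_self_eq_0_iff by simp
  have a: "a = s \<cdot>\<^sub>v b"
  proof (rule eq_vecI)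
    fix i assume "i < dim_vec (s \<cdot>\<^sub>v b)"
    then have "i < n" using assms by simp
    then have "v $ i = 0" using \<open>v = 0\<^sub>v n\<close> by simp
    then show "a $ i = (s \<cdot>\<^sub>v b) $ i"
      using \<open>i < n\<close> assms by (simp add: v_def)
  qed (use assms in simp)
  moreover have "d = s * e"
    using ax x assms by (simp add: a)
  ultimately show ?thesis
    by (rule that)
qed

text \<open>Two forms with the same kernel are proportional, and scaling does not affect the
  divisibility, so one form per hyperplane suffices. The quotient can be taken in
  \<open>poly_ring n\<close> by retraction.\<close>

lemma log_derivations_iff:
  assumes "B \<subseteq> carrier_vec n - {0\<^sub>v n}"
  shows "\<theta> \<in> log_derivations n ((\<lambda>b. hyperplane n b 0) ` B) \<longleftrightarrow>
    \<theta> \<in> derivations n \<and> (\<forall>b\<in>B. linear_form n b dvd \<theta> (linear_form n b))"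
proof (cases "\<theta> \<in> derivations n")
  case True
  have scale: "linear_form n (s \<cdot>\<^sub>v b) = const_poly s * linear_form n b"
    "\<theta> (linear_form n (s \<cdot>\<^sub>v b)) = const_poly s * \<theta> (linear_form n b)" if "b \<in> carrier_vec n" for s b
    using that unfolding derivation_linear_form[OF True]
    by (simp_all add: linear_form_def sum_distrib_left mult.assoc)
  have "(\<forall>H\<in>(\<lambda>b. hyperplane n b 0) ` B. \<forall>a \<in> carrier_vec n. a \<noteq> 0\<^sub>v n \<and> H = hyperplane n a 0 \<longrightarrow>
       (\<exists>g \<in> poly_ring n. \<theta> (linear_form n a) = linear_form n a * g)) \<longleftrightarrow>
      (\<forall>b\<in>B. linear_form n b dvd \<theta> (linear_form n b))" (is "?L \<longleftrightarrow> ?R")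
  proof
    assume L: ?L
    show ?R
    proof
      fix b assume b: "b \<in> B"
      then have "b \<in> carrier_vec n" "b \<noteq> 0\<^sub>v n"
        using assms by auto
      then show "linear_form n b dvd \<theta> (linear_form n b)"
        using L b by (metis dvd_triv_left imageI)
    qed
  next
    assume R: ?R
    show ?L
    proof (intro ballI impI)
      fix H a assume H: "H \<in> (\<lambda>b. hyperplane n b 0) ` B" and a: "a \<in> carrier_vec n"
        and "a \<noteq> 0\<^sub>v n \<and> H = hyperplane n a 0"
      then obtain b where b: "b \<in> B" "hyperplane n a 0 = hyperplane n b 0"
        by auto
      then have b': "b \<in> carrier_vec n" "b \<noteq> 0\<^sub>v n"
        using assms by auto
      obtain s where s: "a = s \<cdot>\<^sub>v b"
        using hyperplane_eq_imp_proportional[OF a b' b(2)] by metis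
      have "linear_form n b dvd \<theta> (linear_form n b)"
        using R b by blast
      then obtain g where "g \<in> poly_ring n" "\<theta> (linear_form n b) = linear_form n b * g"
        by (rule poly_ring_dvdE) (use True in \<open>auto intro: derivations_closed\<close>)
      then show "\<exists>g \<in> poly_ring n. \<theta> (linear_form n a) = linear_form n a * g"
        using scale[OF b'(1)] by (auto simp: s)
    qed
  qed
  then show ?thesis
    using True by (simp add: log_derivations_def)
qed (simp add: log_derivations_def)

text \<open>The triple \<open>(i, j, c)\<close> stands for the hyperplane \<open>x\<^sub>i - x\<^sub>j = c\<close>, with coordinates counted
  from 0.\<close>

definition shi_ish_index :: "nat \<Rightarrow> nat \<Rightarrow> (nat \<times> nat \<times> nat) set" where
  "shi_ish_index l k = {(i, j, c). i < j \<and> j < l \<and>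
     (c = 0 \<or> i = 0 \<and> c \<le> j \<and> c < k \<or> c = 1 \<and> k \<le> Suc i)}"

text \<open>Shifting the indices down by one turns the Ish bound i < j into \<open>c \<le> j\<close>
  and the Shi bound k <= i into \<open>k \<le> Suc i\<close>; the constants \<open>c\<close> are not
  shifted.\<close>

lemma shi_ish_eq:
  assumes "2 \<le> k"
  shows "shi_ish l k = (\<lambda>(i, j, c). diff_hyperplane l (Suc i) (Suc j) (real c)) ` shi_ish_index l k"
    (is "_ = ?h ` _")
proof (intro equalityI subsetI)
  fix H assume "H \<in> shi_ish l k"
  then consider (braid) i j where "H = diff_hyperplane l i j 0" "1 \<le> i" "i < j" "j \<le> l"
    | (ish) i j where "H = diff_hyperplane l 1 j (real i)" "1 \<le> i" "i < j" "j \<le> l" "i < k"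
    | (shi) i j where "H = diff_hyperplane l i j 1" "k \<le> i" "i < j" "j \<le> l"
    unfolding shi_ish_def by blast
  then show "H \<in> ?h ` shi_ish_index l k"
  proof cases
    case braid
    then have "H = ?h (i - 1, j - 1, 0)" "(i - 1, j - 1, 0) \<in> shi_ish_index l k"
      by (auto simp: shi_ish_index_def)
    then show ?thesis by blast
  next
    case ish
    then have "H = ?h (0, j - 1, i)" "(0, j - 1, i) \<in> shi_ish_index l k"
      by (auto simp: shi_ish_index_def)
    then show ?thesis by blast
  next
    case shi
    then have "H = ?h (i - 1, j - 1, 1)" "(i - 1, j - 1, 1) \<in> shi_ish_index l k"
      using assms by (auto simp: shi_ish_index_def)
    then show ?thesis by blast
  qed
next
  fix H assume "H \<in> ?h ` shi_ish_index l k"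
  then obtain i j c where H: "H = diff_hyperplane l (Suc i) (Suc j) (real c)" "i < j" "j < l"
    and c: "c = 0 \<or> i = 0 \<and> c \<le> j \<and> 0 < c \<and> c < k \<or> c = 1 \<and> k \<le> Suc i"
    by (force simp: shi_ish_index_def)
  from c show "H \<in> shi_ish l k"
  proof (elim disjE)
    assume "c = 0"
    then have "H = diff_hyperplane l (Suc i) (Suc j) 0 \<and> 1 \<le> Suc i \<and> Suc i < Suc j \<and> Suc j \<le> l"
      using H by simp
    then show ?thesis unfolding shi_ish_def by blast
  next
    assume "i = 0 \<and> c \<le> j \<and> 0 < c \<and> c < k"
    then have "H = diff_hyperplane l 1 (Suc j) (real c) \<and> 1 \<le> c \<and> c < Suc j \<and> Suc j \<le> l \<and> c < k"
      using H by simp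
    then show ?thesis unfolding shi_ish_def by blast
  next
    assume "c = 1 \<and> k \<le> Suc i"
    then have "H = diff_hyperplane l (Suc i) (Suc j) 1 \<and> k \<le> Suc i \<and> Suc i < Suc j \<and> Suc j \<le> l"
      using H by simp
    then show ?thesis unfolding shi_ish_def by blast
  qed
qed

definition cone_form :: "nat \<Rightarrow> nat \<times> nat \<times> nat \<Rightarrow> real vec" where
  "cone_form l = (\<lambda>(i, j, c).
     unit_vec (Suc l) i - unit_vec (Suc l) j - real c \<cdot>\<^sub>v unit_vec (Suc l) l)"

definition cone_hyperplane :: "nat \<Rightarrow> nat \<times> nat \<times> nat \<Rightarrow> real vec set" where
  "cone_hyperplane l = (\<lambda>(i, j, c). {x \<in> carrier_vec (Suc l). x $ i - x $ j = real c * x $ l})"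

definition infinity_hyperplane :: "nat \<Rightarrow> real vec set" where
  "infinity_hyperplane l = {x \<in> carrier_vec (Suc l). x $ l = 0}"

lemma cone_form_carrier [simp]: "cone_form l t \<in> carrier_vec (Suc l)"
  by (auto simp: cone_form_def split: prod.split)

lemma cone_form_nonzero: "i < j \<Longrightarrow> j < l \<Longrightarrow> cone_form l (i, j, c) \<noteq> 0\<^sub>v (Suc l)"
proof
  assume "i < j" "j < l" "cone_form l (i, j, c) = 0\<^sub>v (Suc l)"
  then have "cone_form l (i, j, c) $ i = 0" by simp
  then show False using \<open>i < j\<close> \<open>j < l\<close> by (simp add: cone_form_def)
qed

lemma cone_hyperplane_eq:
  assumes "i < j" "j < l"
  shows "cone_hyperplane l (i, j, c) = hyperplane (Suc l) (cone_form l (i, j, c)) 0"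
proof -
  have "cone_form l (i, j, c) \<bullet> x = x $ i - x $ j - real c * x $ l" if "x \<in> carrier_vec (Suc l)" for x
    using that assms by (simp add: cone_form_def minus_scalar_prod_distrib[of _ "Suc l"])
  then show ?thesis
    by (auto simp: cone_hyperplane_def hyperplane_def)
qed

lemma infinity_hyperplane_eq: "infinity_hyperplane l = hyperplane (Suc l) (unit_vec (Suc l) l) 0"
  by (auto simp: infinity_hyperplane_def hyperplane_def)

lemma scalar_prod_append_1:
  assumes "a \<in> carrier_vec n" "x \<in> carrier_vec (Suc n)"
  shows "(a @\<^sub>v vec 1 (\<lambda>_. d)) \<bullet> x = a \<bullet> vec n (\<lambda>p. x $ p) + d * x $ n"
  using assms by (simp add: scalar_prod_def)

lemma cone_shi_ish:
  assumes "2 \<le> k"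
  shows "cone_arrangement l (shi_ish l k) =
    insert (infinity_hyperplane l) (cone_hyperplane l ` shi_ish_index l k)"
proof -
  have diff: "diff_hyperplane l (Suc i) (Suc j) c = hyperplane l (unit_vec l i - unit_vec l j) (- c)"
    if "i < j" "j < l" for i j c
    using that by (auto simp: diff_hyperplane_def hyperplane_def minus_scalar_prod_distrib[of _ l])
  have nz: "unit_vec l i - unit_vec l j \<noteq> (0\<^sub>v l :: real vec)" if "i < j" "j < l" for i j
  proof
    assume "unit_vec l i - unit_vec l j = (0\<^sub>v l :: real vec)"
    then have "(unit_vec l i - unit_vec l j) $ i = (0 :: real)" using that by simp
    then show False using that by simp
  qed
  \<comment> \<open>The scale \<open>s\<close> covers all equations of one affine hyperplane;
    homogenizing any of them yields the same linear hyperplane.\<close>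
  have cone: "hyperplane (Suc l) ((s \<cdot>\<^sub>v (unit_vec l i - unit_vec l j)) @\<^sub>v vec 1 (\<lambda>_. s * - real c)) 0 =
      cone_hyperplane l (i, j, c)" if "i < j" "j < l" "s \<noteq> 0" for i j c s
  proof -
    have "((s \<cdot>\<^sub>v (unit_vec l i - unit_vec l j)) @\<^sub>v vec 1 (\<lambda>_. s * - real c)) \<bullet> x =
        s * (x $ i - x $ j - real c * x $ l)" if "x \<in> carrier_vec (Suc l)" for x
      using that \<open>i < j\<close> \<open>j < l\<close>
      by (subst scalar_prod_append_1[of _ l]) (simp_all add: minus_scalar_prod_distrib[of _ l] algebra_simps)
    then show ?thesis
      using that by (auto simp: hyperplane_def cone_hyperplane_def)
  qed
  have "{hyperplane (l + 1) (a @\<^sub>v vec 1 (\<lambda>_. d)) 0 | a d.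
          a \<in> carrier_vec l \<and> a \<noteq> 0\<^sub>v l \<and> hyperplane l a d \<in> shi_ish l k} =
      cone_hyperplane l ` shi_ish_index l k" (is "?L = ?R")
  proof (intro equalityI subsetI)
    fix H assume "H \<in> ?L"
    then obtain a d where H: "H = hyperplane (Suc l) (a @\<^sub>v vec 1 (\<lambda>_. d)) 0"
      and a: "a \<in> carrier_vec l" "a \<noteq> 0\<^sub>v l" "hyperplane l a d \<in> shi_ish l k"
      by auto
    then obtain i j c where t: "(i, j, c) \<in> shi_ish_index l k"
      and eq: "hyperplane l a d = diff_hyperplane l (Suc i) (Suc j) (real c)"
      unfolding shi_ish_eq[OF assms] by auto
    then have ij: "i < j" "j < l"
      by (auto simp: shi_ish_index_def)
    obtain s where s: "a = s \<cdot>\<^sub>v (unit_vec l i - unit_vec l j)" "d = s * - real c"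
      by (rule hyperplane_eq_imp_proportional[OF a(1) _ nz[OF ij] eq[unfolded diff[OF ij]]]) auto
    then have "s \<noteq> 0"
      using a(2) by auto
    then have "H = cone_hyperplane l (i, j, c)"
      unfolding H s using cone ij by blast
    then show "H \<in> ?R"
      using t by blast
  next
    fix H assume "H \<in> ?R"
    then obtain i j c where t: "(i, j, c) \<in> shi_ish_index l k" and H: "H = cone_hyperplane l (i, j, c)"
      by auto
    then have ij: "i < j" "j < l"
      by (auto simp: shi_ish_index_def)
    let ?a = "1 \<cdot>\<^sub>v (unit_vec l i - unit_vec l j) :: real vec"
    have "H = hyperplane (l + 1) (?a @\<^sub>v vec 1 (\<lambda>_. 1 * - real c)) 0"
      using cone[OF ij, of 1 c] H by simp
    moreover have "?a \<in> carrier_vec l" "?a \<noteq> 0\<^sub>v l"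
      using nz[OF ij] by auto
    moreover have "hyperplane l ?a (1 * - real c) \<in> shi_ish l k"
      unfolding shi_ish_eq[OF assms] using t diff[OF ij, of "real c"] by force
    ultimately show "H \<in> ?L"
      by blast
  qed
  then show ?thesis
    by (simp add: cone_arrangement_def infinity_hyperplane_def)
qed

lemma sum_cone_form:
  fixes g :: "nat \<Rightarrow> real_mpoly"
  assumes "i < j" "j < l"
  shows "(\<Sum>p<Suc l. const_poly (cone_form l (i, j, c) $ p) * g p) =
    g i - g j - const_poly (real c) * g l"
proof -
  have "const_poly (cone_form l (i, j, c) $ p) * g p = (if p = i then g p else 0)
      - (if p = j then g p else 0) - (if p = l then const_poly (real c) * g p else 0)" if "p < Suc l" for p
    using that assms by (auto simp: cone_form_def)
  then have "(\<Sum>p<Suc l. const_poly (cone_form l (i, j, c) $ p) * g p) =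
      (\<Sum>p<Suc l. (if p = i then g p else 0) - (if p = j then g p else 0)
         - (if p = l then const_poly (real c) * g p else 0))"
    by (intro sum.cong) auto
  then show ?thesis
    using assms by (simp add: sum_subtractf)
qed

lemma sum_unit_vec:
  fixes g :: "nat \<Rightarrow> real_mpoly"
  assumes "i < n"
  shows "(\<Sum>p<n. const_poly (unit_vec n i $ p) * g p) = g i"
proof -
  have "(\<Sum>p<n. const_poly (unit_vec n i $ p) * g p) = (\<Sum>p<n. if p = i then g p else 0)"
    using assms by (intro sum.cong) auto
  then show ?thesis
    using assms by simp
qed

abbreviation form_poly :: "nat \<Rightarrow> nat \<times> nat \<times> nat \<Rightarrow> real_mpoly" where
  "form_poly l t \<equiv> case t of (i, j, c) \<Rightarrow> var_poly i - var_poly j - const_poly (real c) * var_poly l"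

lemma log_derivations_shi_ish:
  assumes "2 \<le> k"
  shows "\<theta> \<in> log_derivations (Suc l) (cone_arrangement l (shi_ish l k)) \<longleftrightarrow>
    \<theta> \<in> derivations (Suc l) \<and> var_poly l dvd \<theta> (var_poly l) \<and>
    (\<forall>(i, j, c)\<in>shi_ish_index l k. form_poly l (i, j, c) dvd
       \<theta> (var_poly i) - \<theta> (var_poly j) - const_poly (real c) * \<theta> (var_poly l))"
proof -
  let ?B = "insert (unit_vec (Suc l) l) (cone_form l ` shi_ish_index l k)"
  have B: "?B \<subseteq> carrier_vec (Suc l) - {0\<^sub>v (Suc l)}"
    using cone_form_nonzero by (auto simp: shi_ish_index_def)
  have "cone_arrangement l (shi_ish l k) = (\<lambda>b. hyperplane (Suc l) b 0) ` ?B"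
    unfolding cone_shi_ish[OF assms] image_insert image_image
    by (intro arg_cong2[where f = insert] infinity_hyperplane_eq image_cong)
       (auto simp: shi_ish_index_def cone_hyperplane_eq)
  then have "\<theta> \<in> log_derivations (Suc l) (cone_arrangement l (shi_ish l k)) \<longleftrightarrow>
      \<theta> \<in> derivations (Suc l) \<and> (\<forall>b\<in>?B. linear_form (Suc l) b dvd \<theta> (linear_form (Suc l) b))"
    using log_derivations_iff[OF B] by simp
  also have "\<dots> \<longleftrightarrow> \<theta> \<in> derivations (Suc l) \<and> (\<forall>b\<in>?B. (\<Sum>p<Suc l. const_poly (b $ p) * var_poly p) dvd
      (\<Sum>p<Suc l. const_poly (b $ p) * \<theta> (var_poly p)))"
    by (rule conj_cong[OF refl]) (simp only: derivation_linear_form, simp only: linear_form_def)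
  also have "\<dots> \<longleftrightarrow> \<theta> \<in> derivations (Suc l) \<and> var_poly l dvd \<theta> (var_poly l) \<and>
    (\<forall>(i, j, c)\<in>shi_ish_index l k. form_poly l (i, j, c) dvd
       \<theta> (var_poly i) - \<theta> (var_poly j) - const_poly (real c) * \<theta> (var_poly l))"
  proof -
    have "(\<forall>b\<in>?B. (\<Sum>p<Suc l. const_poly (b $ p) * var_poly p) dvd
      (\<Sum>p<Suc l. const_poly (b $ p) * \<theta> (var_poly p))) \<longleftrightarrow> var_poly l dvd \<theta> (var_poly l) \<and>
      (\<forall>t\<in>shi_ish_index l k. (\<Sum>p<Suc l. const_poly (cone_form l t $ p) * var_poly p) dvd
      (\<Sum>p<Suc l. const_poly (cone_form l t $ p) * \<theta> (var_poly p)))"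
      using sum_unit_vec[of l "Suc l" var_poly] sum_unit_vec[of l "Suc l" "\<lambda>p. \<theta> (var_poly p)"]
      by (simp del: sum.lessThan_Suc)
    also have "(\<forall>t\<in>shi_ish_index l k. (\<Sum>p<Suc l. const_poly (cone_form l t $ p) * var_poly p) dvd
      (\<Sum>p<Suc l. const_poly (cone_form l t $ p) * \<theta> (var_poly p))) \<longleftrightarrow>
      (\<forall>(i, j, c)\<in>shi_ish_index l k. form_poly l (i, j, c) dvd
       \<theta> (var_poly i) - \<theta> (var_poly j) - const_poly (real c) * \<theta> (var_poly l))"
      by (rule ball_cong) (auto simp: shi_ish_index_def sum_cone_form simp del: sum.lessThan_Suc)
    finally show ?thesis by simp
  qed
  finally show ?thesis .
qed


section \<open>Saito's criterion\<close>

text \<open>The form is monic in x_i, so this is the remainder theorem. As the substitution maps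
  into an integral domain, the form is prime.\<close>

lemma form_poly_dvd_iff:
  assumes "i < j" "j < l"
  shows "form_poly l (i, j, c) dvd p \<longleftrightarrow>
    subst_mpoly (\<lambda>q. if q = i then var_poly j + const_poly (real c) * var_poly l else var_poly q) p = 0"
    (is "?a dvd p \<longleftrightarrow> subst_mpoly ?s p = 0")
proof
  have "subst_mpoly ?s ?a = 0"
    using assms by (simp add: subst_mpoly_simps)
  then show "?a dvd p \<Longrightarrow> subst_mpoly ?s p = 0"
    by (auto simp: subst_mpoly_simps)
next
  have "?a dvd var_poly q - ?s q" for q
    by (simp add: diff_diff_eq)
  then have "?a dvd p - subst_mpoly ?s p"
    by (rule dvd_diff_subst_mpoly)
  then show "subst_mpoly ?s p = 0 \<Longrightarrow> ?a dvd p"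
    by simp
qed

abbreviation real_eval :: "(nat \<Rightarrow> real) \<Rightarrow> real_mpoly \<Rightarrow> real" where
  "real_eval \<equiv> eval_mpoly (\<lambda>c. c)"

lemma real_eval_simps:
  "real_eval x (const_poly c) = c" "real_eval x (var_poly i) = x i"
  "real_eval x 0 = 0" "real_eval x (p + q) = real_eval x p + real_eval x q"
  "real_eval x (p - q) = real_eval x p - real_eval x q"
  "real_eval x (p * q) = real_eval x p * real_eval x q"
proof -
  have id: "comm_ring_hom (\<lambda>c::real. c)"
    by unfold_locales auto
  interpret comm_ring_hom "real_eval x"
    by (rule eval_mpoly_hom[OF id])
  show "real_eval x 0 = 0" "real_eval x (p + q) = real_eval x p + real_eval x q"
    "real_eval x (p - q) = real_eval x p - real_eval x q"
    "real_eval x (p * q) = real_eval x p * real_eval x q"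
    by (simp_all add: hom_distribs)
  show "real_eval x (const_poly c) = c" "real_eval x (var_poly i) = x i"
    by (simp_all add: eval_mpoly_const[OF id] eval_mpoly_var[OF id])
qed

lemma form_poly_not_dvd:
  assumes "i < j" "j < l" "i' < j'" "j' < l" "(i, j, c) \<noteq> (i', j', c')"
  shows "\<not> form_poly l (i, j, c) dvd form_poly l (i', j', c')"
proof
  assume dvd: "form_poly l (i, j, c) dvd form_poly l (i', j', c')"
  have zero: "x i' - x j' - real c' * x l = 0" if "x i - x j - real c * x l = 0" for x :: "nat \<Rightarrow> real"
    using dvd that by (auto simp: real_eval_simps elim!: dvdE dest!: arg_cong[where f = "real_eval x"])
  \<comment> \<open>The test point has z = 0 and lies on the first hyperplane; its coordinates below
    l are distinct except that the i-th equals the j-th.\<close>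
  have "(i, j) = (i', j')"
    using zero[of "\<lambda>p. if p = i then real j else if p = l then 0 else real p"] assms
    by (auto split: if_splits)
  \<comment> \<open>Now z = 1, x_i = c and all other coordinates vanish; with equal index pairs the
    second equation reads c = c'.\<close>
  moreover from this have "c = c'"
    using zero[of "\<lambda>p. if p = i then real c else if p = l then 1 else 0"] assms
    by (auto split: if_splits)
  ultimately show False
    using assms(5) by simp
qed

text \<open>The forms are prime and none divides another, so they can be split off one by one: the
  substitution that kills one form does not kill the product of the others, hence it kills the
  cofactor.\<close>

lemma prod_form_poly_dvd:
  assumes "finite S" "S \<subseteq> {(i, j, c). i < j \<and> j < l}" "\<And>t. t \<in> S \<Longrightarrow> form_poly l t dvd p"
  shows "(\<Prod>t\<in>S. form_poly l t) dvd p"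
  using assms
proof (induction S)
  case (insert t S)
  obtain i j c where t: "t = (i, j, c)" "i < j" "j < l"
    using insert.prems(1) by auto
  let ?s = "\<lambda>q. if q = i then var_poly j + const_poly (real c) * var_poly l else var_poly q"
  interpret comm_ring_hom "subst_mpoly ?s"
    by (rule subst_mpoly_hom)
  have "(\<Prod>t\<in>S. form_poly l t) dvd p"
    using insert by auto
  then obtain q where q: "p = (\<Prod>t\<in>S. form_poly l t) * q"
    by (rule dvdE)
  have "subst_mpoly ?s p = 0"
    using insert.prems(2)[of t] form_poly_dvd_iff[OF t(2,3)] unfolding t(1) by blast
  moreover have "subst_mpoly ?s (form_poly l t') \<noteq> 0" if t': "t' \<in> S" for t'
  proof -
    obtain i' j' c' where "t' = (i', j', c')" "i' < j'" "j' < l"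
      using insert.prems(1) t' by auto
    moreover from this have "\<not> form_poly l t dvd form_poly l t'"
      using form_poly_not_dvd[of i j l i' j' c c'] t insert.hyps t' by auto
    ultimately show ?thesis
      using form_poly_dvd_iff[OF t(2,3)] unfolding t(1) by blast
  qed
  then have "subst_mpoly ?s (\<Prod>t\<in>S. form_poly l t) \<noteq> 0"
    using insert.hyps by (simp add: hom_prod)
  ultimately have "subst_mpoly ?s q = 0"
    unfolding q by (simp add: subst_mpoly_simps)
  then have "form_poly l t dvd q"
    using form_poly_dvd_iff[OF t(2,3)] unfolding t(1) by blast
  then show ?case
    using insert.hyps unfolding q by (simp add: mult.commute mult_dvd_mono)
qed simp

lemma form_poly_nonzero: "i < j \<Longrightarrow> j < l \<Longrightarrow> form_poly l (i, j, c) \<noteq> 0"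
proof
  assume "i < j" "j < l" "form_poly l (i, j, c) = 0"
  then have "real_eval (\<lambda>p. if p = i then 1 else 0) (form_poly l (i, j, c)) = 0"
    by (simp add: real_eval_simps)
  then show False
    using \<open>i < j\<close> \<open>j < l\<close> by (simp add: real_eval_simps)
qed

text \<open>The pair \<open>i < j\<close> accounts for \<open>x\<^sub>i = x\<^sub>j\<close> and for one further hyperplane, namely
  \<open>x\<^sub>0 - x\<^sub>j = i + 1\<close> or \<open>x\<^sub>i - x\<^sub>j = 1\<close>, depending on whether \<open>i + 1 < k\<close>.\<close>

lemma card_shi_ish_index:
  assumes "2 \<le> k"
  shows "finite (shi_ish_index l k)" "card (shi_ish_index l k) = l * (l - 1)"
proof -
  let ?P = "SIGMA j:{..<l}. {..<j}"
  let ?f = "\<lambda>(j, i). (i, j, 0::nat)"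
  let ?g = "\<lambda>(j, i). if Suc i < k then (0, j, Suc i) else (i, j, 1::nat)"
  have fin: "finite ?P" by auto
  have eq: "shi_ish_index l k = ?f ` ?P \<union> ?g ` ?P"
  proof (intro equalityI subsetI)
    fix t assume "t \<in> shi_ish_index l k"
    then obtain i j c where t: "t = (i, j, c)" "i < j" "j < l"
      and c: "c = 0 \<or> i = 0 \<and> c \<le> j \<and> 0 < c \<and> c < k \<or> c = 1 \<and> k \<le> Suc i"
      by (force simp: shi_ish_index_def)
    from c show "t \<in> ?f ` ?P \<union> ?g ` ?P"
    proof (elim disjE)
      assume "c = 0"
      then show ?thesis using t by force
    next
      assume "i = 0 \<and> c \<le> j \<and> 0 < c \<and> c < k"
      then have "t = ?g (j, c - 1)" "(j, c - 1) \<in> ?P" using t by auto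
      then show ?thesis by blast
    next
      assume "c = 1 \<and> k \<le> Suc i"
      then have "t = ?g (j, i)" "(j, i) \<in> ?P" using t by auto
      then show ?thesis by blast
    qed
  qed (auto simp: shi_ish_index_def split: if_splits)
  then show "finite (shi_ish_index l k)"
    using fin by auto
  have "inj_on ?f ?P" by (auto simp: inj_on_def)
  moreover have "inj_on ?g ?P"
    using assms by (auto simp: inj_on_def split: if_splits)
  moreover have "?f ` ?P \<inter> ?g ` ?P = {}"
    by (auto split: if_splits)
  ultimately have "card (shi_ish_index l k) = 2 * card ?P"
    unfolding eq using fin by (simp add: card_Un_disjoint card_image)
  also have "card ?P = (\<Sum>j<l. j)" by simp
  also have "2 * (\<Sum>j<l. j) = l * (l - 1)"
  proof (induction l)
    case (Suc l)
    then show ?case by (cases l) auto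
  qed simp
  finally show "card (shi_ish_index l k) = l * (l - 1)" .
qed

text \<open>The values on the x_j that remain after subtracting multiples of the Euler derivation
  and of the sum of the partial derivatives in the x_j, which normalizes the values at z and x_0 to
  zero.\<close>

definition log_tuple :: "nat \<Rightarrow> nat \<Rightarrow> (nat \<Rightarrow> real_mpoly) \<Rightarrow> bool" where
  "log_tuple l k f \<longleftrightarrow> f 0 = 0 \<and> (\<forall>(i, j, c)\<in>shi_ish_index l k. form_poly l (i, j, c) dvd f i - f j)"

text \<open>On the hyperplane x_i = x_j + c z the rows of x_i and x_j coincide; for i = 0 the row of
  x_j vanishes, because every tuple is zero at 0.\<close>

lemma prod_form_poly_dvd_det:
  assumes "2 \<le> k" "\<And>m. m < l - 1 \<Longrightarrow> log_tuple l k (g m)"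
  shows "(\<Prod>t\<in>shi_ish_index l k. form_poly l t) dvd det (mat (l - 1) (l - 1) (\<lambda>(a, m). g m (Suc a)))"
    (is "_ dvd det ?B")
proof (rule prod_form_poly_dvd)
  show "finite (shi_ish_index l k)" by (rule card_shi_ish_index[OF assms(1)])
  show "shi_ish_index l k \<subseteq> {(i, j, c). i < j \<and> j < l}" by (auto simp: shi_ish_index_def)
  fix t assume t': "t \<in> shi_ish_index l k"
  then obtain i j c where t: "t = (i, j, c)" and ij: "i < j" "j < l"
    by (auto simp: shi_ish_index_def)
  let ?s = "\<lambda>q. if q = i then var_poly j + const_poly (real c) * var_poly l else var_poly q"
  interpret comm_ring_hom "subst_mpoly ?s"
    by (rule subst_mpoly_hom)
  let ?M = "map_mat (subst_mpoly ?s) ?B"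
  have eq: "subst_mpoly ?s (g m i) = subst_mpoly ?s (g m j)" "subst_mpoly ?s (g m 0) = 0"
    if "m < l - 1" for m
  proof -
    have "form_poly l (i, j, c) dvd g m i - g m j" "g m 0 = 0"
      using assms(2)[OF that] t' t unfolding log_tuple_def by auto
    then show "subst_mpoly ?s (g m i) = subst_mpoly ?s (g m j)" "subst_mpoly ?s (g m 0) = 0"
      unfolding form_poly_dvd_iff[OF ij] by (simp_all add: subst_mpoly_simps)
  qed
  \<comment> \<open>The relation (row of x_j) - (row of x_i), where row \<open>a\<close> belongs to
    x_(a+1). For i = 0 the second term never occurs.\<close>
  define v :: "real_mpoly vec"
    where "v = vec (l - 1) (\<lambda>a. (if a = j - 1 then 1 else 0) - (if Suc a = i then 1 else 0))"
  have v: "v \<in> carrier_vec (l - 1)" by (simp add: v_def)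
  have "v $ (j - 1) = 1" using ij by (simp add: v_def)
  then have "v \<noteq> 0\<^sub>v (l - 1)" using ij by auto
  moreover have "?M\<^sup>T *\<^sub>v v = 0\<^sub>v (l - 1)"
  proof (rule eq_vecI)
    fix m assume "m < dim_vec (0\<^sub>v (l - 1) :: real_mpoly vec)"
    then have m: "m < l - 1" by simp
    let ?h = "\<lambda>p. subst_mpoly ?s (g m p)"
    have "(?M\<^sup>T *\<^sub>v v) $ m = (\<Sum>a\<in>{0..<l - 1}. ?h (Suc a) * v $ a)"
      using m by (simp add: scalar_prod_def v_def)
    also have "\<dots> = (\<Sum>a\<in>{0..<l - 1}. (if a = j - 1 then ?h (Suc a) else 0) - (if Suc a = i then ?h (Suc a) else 0))"
      by (intro sum.cong) (auto simp: v_def)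
    also have "\<dots> = ?h j - (\<Sum>a\<in>{0..<l - 1}. if Suc a = i then ?h (Suc a) else 0)"
      using ij by (simp add: sum_subtractf)
    also have "(\<Sum>a\<in>{0..<l - 1}. if Suc a = i then ?h (Suc a) else 0) = ?h i"
      by (cases i) (use ij eq[OF m] in auto)
    finally show "(?M\<^sup>T *\<^sub>v v) $ m = (0\<^sub>v (l - 1)) $ m"
      using eq[OF m] m by simp
  qed simp
  ultimately have "det (?M\<^sup>T) = 0"
    using v by (subst det_0_iff_vec_prod_zero[of _ "l - 1"]) auto
  then have "det ?M = 0"
    by (subst (asm) det_transpose[of _ "l - 1"]) auto
  then have "subst_mpoly ?s (det ?B) = 0"
    by (simp only: hom_det)
  then show "form_poly l t dvd det ?B"
    using form_poly_dvd_iff[OF ij] unfolding t by blast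
qed

text \<open>Cramer's rule without division: both sides are the Laplace expansion along column
  \<open>k\<close>, whose cofactors do not see the replaced column.\<close>

lemma adj_mat_mult_vec:
  fixes A :: "'a::comm_ring_1 mat"
  assumes A: "A \<in> carrier_mat n n" and b: "b \<in> carrier_vec n" and k: "k < n"
  shows "(adj_mat A *\<^sub>v b) $ k = det (replace_col A b k)"
proof -
  have Ab: "replace_col A b k \<in> carrier_mat n n"
    using A by (auto simp: replace_col_def)
  have "(adj_mat A *\<^sub>v b) $ k = row (adj_mat A) k \<bullet> b"
    using adj_mat(1)[OF A] b k by auto
  also have "\<dots> = det (replace_col A b k)"
    unfolding scalar_prod_def using b k A
    by (subst laplace_expansion_column[OF Ab k], auto intro!: sum.cong arg_cong[of _ _ det]
      arg_cong[of _ _ "\<lambda> x. _ * x"] eq_matI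
      simp: replace_col_def adj_mat_def Matrix.row_def cofactor_def mat_delete_def ac_simps)
  finally show ?thesis .
qed

lemma det_in_poly_ring:
  assumes "A \<in> carrier_mat n n" "\<And>i j. i < n \<Longrightarrow> j < n \<Longrightarrow> A $$ (i, j) \<in> poly_ring N"
  shows "det A \<in> poly_ring N"
proof -
  have "signof p * (\<Prod>i\<in>{0..<n}. A $$ (i, p i)) \<in> poly_ring N" if "p permutes {0..<n}" for p
  proof -
    have "(\<Prod>i\<in>{0..<n}. A $$ (i, p i)) \<in> poly_ring N"
      by (rule poly_ring_prod) (use assms(2) permutes_in_image[OF that] in auto)
    then show ?thesis
      by (simp add: sign_def)
  qed
  then show ?thesis
    unfolding det_def'[OF assms(1)] by (intro poly_ring_sum) auto
qed

text \<open>Saito's criterion: the coefficients given by Cramer's rule are polynomial, since every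
  determinant of logarithmic columns is divisible by the product of the defining forms.\<close>

lemma log_tuple_generated:
  assumes "2 \<le> k" and f: "log_tuple l k f"
    and g: "\<And>m. m < l - 1 \<Longrightarrow> log_tuple l k (g m)"
    and det: "det (mat (l - 1) (l - 1) (\<lambda>(a, m). g m (Suc a))) =
      const_poly r * (\<Prod>t\<in>shi_ish_index l k. form_poly l t)" and "r \<noteq> 0"
    and ring: "\<And>j. j < l \<Longrightarrow> f j \<in> poly_ring (Suc l)"
      "\<And>m j. m < l - 1 \<Longrightarrow> j < l \<Longrightarrow> g m j \<in> poly_ring (Suc l)"
  obtains q where "\<And>m. m < l - 1 \<Longrightarrow> q m \<in> poly_ring (Suc l)"
    "\<And>j. j < l \<Longrightarrow> f j = (\<Sum>m<l - 1. q m * g m j)"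
proof -
  let ?n = "l - 1"
  let ?Q = "\<Prod>t\<in>shi_ish_index l k. form_poly l t"
  let ?A = "mat ?n ?n (\<lambda>(a, m). g m (Suc a))"
  let ?b = "vec ?n (\<lambda>a. f (Suc a))"
  have Q: "?Q \<noteq> 0"
    using card_shi_ish_index(1)[OF assms(1)] form_poly_nonzero by (auto simp: shi_ish_index_def)
  have A: "?A \<in> carrier_mat ?n ?n" and b: "?b \<in> carrier_vec ?n" by auto
  let ?x = "adj_mat ?A *\<^sub>v ?b"
  have x: "?x $ m = det (mat ?n ?n (\<lambda>(a, m'). (if m' = m then f else g m') (Suc a)))" if "m < ?n" for m
  proof -
    have "?x $ m = det (replace_col ?A ?b m)"
      by (rule adj_mat_mult_vec[OF A b that])
    also have "replace_col ?A ?b m = mat ?n ?n (\<lambda>(a, m'). (if m' = m then f else g m') (Suc a))"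
      by (rule eq_matI) (auto simp: replace_col_def)
    finally show ?thesis .
  qed
  have "\<exists>q\<in>poly_ring (Suc l). ?x $ m = ?Q * q" if "m < ?n" for m
  proof -
    have "?Q dvd ?x $ m"
      unfolding x[OF that]
      by (rule prod_form_poly_dvd_det[OF assms(1)]) (use f g in simp)
    moreover have "?Q \<in> poly_ring (Suc l)"
      by (rule poly_ring_prod) (auto simp: shi_ish_index_def)
    moreover have "?x $ m \<in> poly_ring (Suc l)"
      unfolding x[OF that] by (rule det_in_poly_ring[where n = ?n]) (use ring in auto)
    ultimately obtain q where "q \<in> poly_ring (Suc l)" "?x $ m = ?Q * q"
      by (rule poly_ring_dvdE)
    then show ?thesis
      by (intro bexI)
  qed
  then obtain q where q: "\<And>m. m < ?n \<Longrightarrow> ?x $ m = ?Q * q m" "\<And>m. m < ?n \<Longrightarrow> q m \<in> poly_ring (Suc l)"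
    by metis
  define q' where "q' m = const_poly (1 / r) * q m" for m
  have r: "const_poly r * const_poly (1 / r) = 1"
    using \<open>r \<noteq> 0\<close> by (metis const_poly_simps(2,4) nonzero_mult_div_cancel_left times_divide_eq_right mult_1_right)
  have q': "const_poly r * ?Q * q' m = ?x $ m" if "m < ?n" for m
  proof -
    have "const_poly r * ?Q * q' m = (const_poly r * const_poly (1 / r)) * (?Q * q m)"
      unfolding q'_def by (simp only: mult_ac)
    then show ?thesis
      using r q(1)[OF that] by simp
  qed
  have sol: "?A *\<^sub>v ?x = (const_poly r * ?Q) \<cdot>\<^sub>v ?b"
  proof -
    have "?A *\<^sub>v ?x = (?A * adj_mat ?A) *\<^sub>v ?b"
      by (rule assoc_mult_mat_vec[OF A adj_mat(1)[OF A] b, symmetric])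
    also have "\<dots> = (const_poly r * ?Q) \<cdot>\<^sub>v ?b"
      unfolding adj_mat(2)[OF A] det by (rule eq_vecI) auto
    finally show ?thesis .
  qed
  have "f j = (\<Sum>m<?n. q' m * g m j)" if "j < l" for j
  proof (cases j)
    case 0
    then show ?thesis using f g by (simp add: log_tuple_def)
  next
    case (Suc a)
    then have a: "a < ?n" using that by simp
    have "const_poly r * ?Q * f j = (\<Sum>m\<in>{0..<?n}. g m j * ?x $ m)"
      using arg_cong[OF sol, of "\<lambda>v. v $ a"] a Suc adj_mat(1)[OF A]
      by (simp add: scalar_prod_def)
    also have "\<dots> = const_poly r * ?Q * (\<Sum>m<?n. q' m * g m j)"
      unfolding sum_distrib_left using q' by (intro sum.cong) (auto simp: algebra_simps)
    finally show ?thesis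
      using Q \<open>r \<noteq> 0\<close> by simp
  qed
  moreover have "q' m \<in> poly_ring (Suc l)" if "m < ?n" for m
    using q(2)[OF that] by (simp add: q'_def)
  ultimately show ?thesis
    using that by blast
qed


section \<open>Inverting the difference operator\<close>

text \<open>The eigenvalue form of homogeneity, which passes to products because substitution is
  multiplicative. Zero is graded in every degree.\<close>

definition graded :: "nat \<Rightarrow> nat \<Rightarrow> real_mpoly \<Rightarrow> bool" where
  "graded N d p \<longleftrightarrow> p \<in> poly_ring N \<and> double_vars p = const_poly 2 ^ d * p"

lemma graded_add: "graded N d p \<Longrightarrow> graded N d q \<Longrightarrow> graded N d (p + q)"
  by (simp add: graded_def subst_mpoly_simps algebra_simps)

lemma graded_diff: "graded N d p \<Longrightarrow> graded N d q \<Longrightarrow> graded N d (p - q)"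
  by (simp add: graded_def subst_mpoly_simps algebra_simps)

lemma graded_mult: "graded N d p \<Longrightarrow> graded N e q \<Longrightarrow> graded N (d + e) (p * q)"
  by (simp add: graded_def subst_mpoly_simps power_add mult_ac)

lemma graded_const: "graded N 0 (const_poly c)"
  by (simp add: graded_def subst_mpoly_simps)

lemma graded_var: "i < N \<Longrightarrow> graded N 1 (var_poly i)"
  by (simp add: graded_def subst_mpoly_simps)

lemma graded_zero: "graded N d 0"
  by (simp add: graded_def subst_mpoly_simps)

lemma graded_const_mult: "graded N d p \<Longrightarrow> graded N d (const_poly c * p)"
  using graded_mult[OF graded_const, of N d p c] by simp

lemma graded_sum: "(\<And>i. i \<in> S \<Longrightarrow> graded N d (f i)) \<Longrightarrow> graded N d (sum f S)"
  by (induction S rule: infinite_finite_induct) (auto intro: graded_zero graded_add)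

lemma graded_prod:
  assumes "finite S" "\<And>i. i \<in> S \<Longrightarrow> graded N 1 (f i)"
  shows "graded N (card S) (prod f S)"
  using assms
proof (induction S)
  case empty
  then show ?case using graded_const[of N 1] by simp
next
  case (insert i S)
  then show ?case using graded_mult[of N 1 "f i" "card S" "prod f S"] by simp
qed

lemma graded_imp_homogeneous: "graded N d p \<Longrightarrow> homogeneous_poly d p"
  by (simp add: graded_def homogeneous_poly_if_double_vars)

text \<open>The Newton basis with nodes a z, (a + 1) z, ... prepares for termwise summation; the
  r-th coefficient has the complementary degree.\<close>

lemma newton_expansion:
  assumes "\<forall>w\<in>set ws. graded N 1 w" and "graded N 1 z"
  shows "\<exists>h. (\<forall>r\<le>length ws. graded N (length ws - r) (h r)) \<and>
    (\<forall>t. (\<Prod>w\<leftarrow>ws. t - w) = (\<Sum>r\<le>length ws. h r * (\<Prod>i<r. t - const_poly (real (a + i)) * z)))"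
  using assms(1)
proof (induction ws)
  case Nil
  show ?case
    by (rule exI[of _ "\<lambda>_. 1"]) (use graded_const[of N 1] in simp)
next
  case (Cons w ws)
  let ?n = "length ws"
  let ?T = "\<lambda>t r. \<Prod>i<r. t - const_poly (real (a + i)) * z"
  let ?u = "\<lambda>r. const_poly (real (a + r)) * z - w"
  obtain h where h: "\<And>r. r \<le> ?n \<Longrightarrow> graded N (?n - r) (h r)"
    and exp: "\<And>t. (\<Prod>w\<leftarrow>ws. t - w) = (\<Sum>r\<le>?n. h r * ?T t r)"
    using Cons by auto
  \<comment> \<open>From t - w = (t - (a + r) z) + ((a + r) z - w): the first summand raises the
    Newton index by one, the second keeps it.\<close>
  define h' where "h' r = (if r = 0 then 0 else h (r - 1)) + (if r \<le> ?n then ?u r * h r else 0)" for r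
  have "graded N (Suc ?n - r) (h' r)" if "r \<le> Suc ?n" for r
  proof -
    have "graded N (Suc ?n - r) (if r = 0 then 0 else h (r - 1))"
      using h[of "r - 1"] that by (cases r) (auto intro: graded_zero)
    moreover have "graded N (Suc ?n - r) (if r \<le> ?n then ?u r * h r else 0)"
    proof (cases "r \<le> ?n")
      case True
      have "graded N 1 (?u r)"
        using Cons.prems assms(2) by (intro graded_diff graded_const_mult) auto
      then have "graded N (1 + (?n - r)) (?u r * h r)"
        by (rule graded_mult) (rule h[OF True])
      then show ?thesis using True by (simp add: Suc_diff_le)
    qed (simp add: graded_zero)
    ultimately show ?thesis
      unfolding h'_def by (rule graded_add)
  qed
  moreover have "(\<Prod>w\<leftarrow>w # ws. t - w) = (\<Sum>r\<le>Suc ?n. h' r * ?T t r)" for t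
  proof -
    have "(\<Sum>r\<le>Suc ?n. h' r * ?T t r) = (\<Sum>r\<le>Suc ?n. (if r = 0 then 0 else h (r - 1)) * ?T t r)
        + (\<Sum>r\<le>Suc ?n. (if r \<le> ?n then ?u r * h r else 0) * ?T t r)"
      by (simp only: h'_def distrib_right sum.distrib)
    also have "(\<Sum>r\<le>Suc ?n. (if r = 0 then 0 else h (r - 1)) * ?T t r) = (\<Sum>r\<le>?n. h r * ?T t (Suc r))"
      by (subst sum.atMost_Suc_shift) simp
    also have "(\<Sum>r\<le>Suc ?n. (if r \<le> ?n then ?u r * h r else 0) * ?T t r) = (\<Sum>r\<le>?n. ?u r * h r * ?T t r)"
      by simp
    also have "(\<Sum>r\<le>?n. h r * ?T t (Suc r)) + (\<Sum>r\<le>?n. ?u r * h r * ?T t r) =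
        (\<Sum>r\<le>?n. (t - w) * (h r * ?T t r))"
      unfolding sum.distrib[symmetric]
      by (intro sum.cong refl) (simp only: prod.lessThan_Suc, simp add: algebra_simps)
    also have "\<dots> = (\<Prod>w\<leftarrow>w # ws. t - w)"
      by (simp add: exp sum_distrib_left)
    finally show ?thesis ..
  qed
  ultimately show ?case
    by (intro exI[of _ h']) simp
qed

text \<open>The discrete power rule: both products contain t (t - z) ... (t - (s - 1) z), and the
  remaining factors differ by (t + z) - (t - s z) = (s + 1) z.\<close>

lemma falling_shift:
  fixes z t :: real_mpoly
  shows "(\<Prod>i<Suc s. t + z - const_poly (real i) * z) - (\<Prod>i<Suc s. t - const_poly (real i) * z) =
    const_poly (real (Suc s)) * z * (\<Prod>i<s. t - const_poly (real i) * z)"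
proof -
  have "(\<Prod>i<Suc s. t + z - const_poly (real i) * z) = (t + z) * (\<Prod>i<s. t - const_poly (real i) * z)"
    by (subst prod.lessThan_Suc_shift) (simp add: algebra_simps)
  moreover have "(\<Prod>i<Suc s. t - const_poly (real i) * z) =
      (t - const_poly (real s) * z) * (\<Prod>i<s. t - const_poly (real i) * z)"
    by simp
  ultimately show ?thesis
    by (simp only: of_nat_Suc const_poly_simps) (simp add: algebra_simps)
qed

text \<open>The falling factorials \<open>t (t - z) \<dots> (t - r z)\<close> turn the difference operator of step \<open>z\<close> into a
  formal derivative, so it can be inverted on any product of linear factors.\<close>

lemma exists_summation_poly:
  assumes ws: "\<forall>w\<in>set ws. graded N 1 w" and z: "graded N 1 z"
  shows "\<exists>F. degree F \<le> Suc s + length ws \<and> (\<forall>c\<le>s. poly F (const_poly (real c) * z) = 0) \<and>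
    (\<forall>t. poly F (t + z) - poly F t = z * (\<Prod>i<s. t - const_poly (real i) * z) * (\<Prod>w\<leftarrow>ws. t - w)) \<and>
    (\<forall>t. graded N 1 t \<longrightarrow> graded N (Suc s + length ws) (poly F t))"
proof -
  let ?n = "length ws"
  \<comment> \<open>The nodes start at s z, so that the r-th Newton product completes the first s
    falling factors to the falling factorial of length s + r.\<close>
  obtain h where h: "\<And>r. r \<le> ?n \<Longrightarrow> graded N (?n - r) (h r)"
    and exp: "\<And>t. (\<Prod>w\<leftarrow>ws. t - w) = (\<Sum>r\<le>?n. h r * (\<Prod>i<r. t - const_poly (real (s + i)) * z))"
    using newton_expansion[OF ws z, of s] by blast
  let ?ff = "\<lambda>t r. \<Prod>i<r. t - const_poly (real i) * z"
  define ff where "ff r = (\<Prod>i<r. [:- (const_poly (real i) * z), 1:])" for r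
  have poly_ff: "poly (ff r) t = ?ff t r" for r t
    by (simp add: ff_def poly_prod)
  have deg_ff: "degree (ff r) \<le> r" for r
    unfolding ff_def by (rule order.trans[OF degree_prod_sum_le]) auto
  \<comment> \<open>Division by the factor s + 1 + r that the power rule produces.\<close>
  define e where "e r = const_poly (1 / real (Suc s + r)) * h r" for r
  have e: "e r * const_poly (real (Suc s + r)) = h r" for r
  proof -
    have "e r * const_poly (real (Suc s + r)) = h r * const_poly (1 / real (Suc s + r) * real (Suc s + r))"
      unfolding e_def const_poly_simps(4) by (simp only: mult_ac)
    also have "1 / real (Suc s + r) * real (Suc s + r) = 1"
      by (simp del: of_nat_Suc of_nat_add)
    finally show ?thesis by simp
  qed
  define F where "F = (\<Sum>r\<le>?n. smult (e r) (ff (Suc s + r)))"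
  have poly_F: "poly F t = (\<Sum>r\<le>?n. e r * ?ff t (Suc s + r))" for t
    by (simp only: F_def poly_sum poly_smult poly_ff)
  have "degree F \<le> Suc s + ?n"
    unfolding F_def
  proof (rule degree_sum_le)
    fix r assume "r \<in> {..?n}"
    then show "degree (smult (e r) (ff (Suc s + r))) \<le> Suc s + ?n"
      using degree_smult_le[of "e r" "ff (Suc s + r)"] deg_ff[of "Suc s + r"] by simp
  qed simp
  moreover have "poly F (const_poly (real c) * z) = 0" if "c \<le> s" for c
  proof -
    have "?ff (const_poly (real c) * z) (Suc s + r) = 0" for r
      by (rule prod_zero) (use that in \<open>auto intro!: bexI[of _ c]\<close>)
    then show ?thesis by (simp only: poly_F mult_zero_right sum.neutral_const)
  qed
  moreover have "poly F (t + z) - poly F t = z * ?ff t s * (\<Prod>w\<leftarrow>ws. t - w)" for t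
  proof -
    have step: "e r * ?ff (t + z) (Suc s + r) - e r * ?ff t (Suc s + r) =
        z * ?ff t s * (h r * (\<Prod>i<r. t - const_poly (real (s + i)) * z))" for r
    proof -
      have "e r * ?ff (t + z) (Suc s + r) - e r * ?ff t (Suc s + r) =
          e r * (const_poly (real (Suc s + r)) * z * ?ff t (s + r))"
        unfolding add_Suc right_diff_distrib[symmetric] falling_shift ..
      also have "\<dots> = h r * z * ?ff t (s + r)"
        by (simp only: mult.assoc[symmetric] e)
      also have "?ff t (s + r) = ?ff t s * (\<Prod>i<r. t - const_poly (real (s + i)) * z)"
        by (induction r) (simp_all only: add_0_right add_Suc_right prod.lessThan_Suc lessThan_0 prod.empty
            mult_1_right mult.assoc)
      finally show ?thesis by (simp only: mult_ac)
    qed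
    show ?thesis
      unfolding poly_F sum_subtractf[symmetric] step exp sum_distrib_left ..
  qed
  moreover have "graded N (Suc s + ?n) (poly F t)" if "graded N 1 t" for t
  proof -
    have "graded N (Suc s + ?n) (e r * ?ff t (Suc s + r))" if r: "r \<le> ?n" for r
    proof -
      have "graded N (card {..<Suc s + r}) (?ff t (Suc s + r))"
        by (intro graded_prod graded_diff graded_const_mult) (use z \<open>graded N 1 t\<close> in auto)
      moreover have "graded N (?n - r) (e r)"
        unfolding e_def by (intro graded_const_mult h r)
      ultimately have "graded N ((?n - r) + (Suc s + r)) (e r * ?ff t (Suc s + r))"
        using graded_mult by (metis card_lessThan)
      moreover have "(?n - r) + (Suc s + r) = Suc s + ?n" using r by simp
      ultimately show ?thesis by (simp only:)
    qed
    then show ?thesis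
      unfolding poly_F by (intro graded_sum) auto
  qed
  ultimately show ?thesis
    by blast
qed

lemma diff_dvd_poly_diff: "a - b dvd poly p a - poly p b" for p :: "'a::comm_ring_1 poly"
proof (induction p)
  case (pCons c p)
  have "poly (pCons c p) a - poly (pCons c p) b = (a - b) * poly p a + b * (poly p a - poly p b)"
    by (simp add: algebra_simps)
  then show ?case
    using pCons.IH by (metis dvd_add dvd_mult dvd_triv_left)
qed simp


section \<open>The basis\<close>

abbreviation rel_var :: "nat \<Rightarrow> real_mpoly" where
  "rel_var p \<equiv> var_poly 0 - var_poly p"

text \<open>With y_p = \<open>rel_var p\<close>, a root y_p makes the prescribed difference vanish
  at y_p, while a root y_p - z makes its value at y_i divisible by y_i + z - y_p. For k - 1 <= m < l
  there are l - k roots, so that the summed polynomial takes values of degree l on linear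
  forms.\<close>

definition shi_roots :: "nat \<Rightarrow> nat \<Rightarrow> nat \<Rightarrow> real_mpoly list" where
  "shi_roots l k m = map rel_var [k - 1..<m] @ map (\<lambda>p. rel_var p - var_poly l) [Suc m..<l]"

text \<open>In terms of \<open>y\<^sub>j = x\<^sub>0 - x\<^sub>j\<close>, the basis derivation with index \<open>m\<close> is \<open>x\<^sub>j \<mapsto> F(y\<^sub>j)\<close>. For
  \<open>m + 1 < k\<close> the polynomial \<open>F\<close> is a product of linear factors as for the Ish arrangement; otherwise
  it is prescribed by its differences, which are chosen to vanish where the Shi part requires it.\<close>

definition basis_poly :: "nat \<Rightarrow> nat \<Rightarrow> nat \<Rightarrow> real_mpoly poly \<Rightarrow> bool" where
  "basis_poly l k m F \<longleftrightarrow>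
     (\<forall>t. graded (Suc l) 1 t \<longrightarrow> graded (Suc l) l (poly F t)) \<and>
     (if Suc m < k then (\<forall>c\<le>m. poly F (const_poly (real c) * var_poly l) = 0) \<and>
          (\<forall>p. m < p \<and> p < l \<longrightarrow> poly F (rel_var p) = 0) \<and> poly F (rel_var m) \<noteq> 0
      else degree F \<le> l \<and> (\<forall>c<k. poly F (const_poly (real c) * var_poly l) = 0) \<and>
          (\<forall>t. poly F (t + var_poly l) - poly F t =
             var_poly l * (\<Prod>i<k - 1. t - const_poly (real i) * var_poly l) *
             (\<Prod>w\<leftarrow>shi_roots l k m. t - w)))"

section \<open>Degrees and nonvanishing of the linear factors\<close>

lemma rel_var_graded: "p < N \<Longrightarrow> graded N 1 (rel_var p)"
  by (intro graded_diff graded_var) auto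

lemma nonzero_if_real_eval: "real_eval x p \<noteq> 0 \<Longrightarrow> p \<noteq> 0"
  by (auto simp: real_eval_simps)

lemma var_poly_nonzero [simp]: "var_poly i \<noteq> 0"
  by (rule nonzero_if_real_eval[of "\<lambda>_. 1"]) (simp add: real_eval_simps)

lemma rel_var_diff_nonzero: "p \<noteq> q \<Longrightarrow> rel_var p - rel_var q \<noteq> 0"
  by (rule nonzero_if_real_eval[of "\<lambda>i. if i = q then 1 else 0"]) (simp add: real_eval_simps)

lemma rel_var_diff_nonzero':
  "p < l \<Longrightarrow> q < l \<Longrightarrow> rel_var p - (rel_var q - var_poly l) \<noteq> 0"
  by (rule nonzero_if_real_eval[of "\<lambda>i. if i = l then 1 else 0"]) (simp add: real_eval_simps)

lemma rel_var_minus_multiple_nonzero: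
  "0 < p \<Longrightarrow> p < l \<Longrightarrow> rel_var p - const_poly (real c) * var_poly l \<noteq> 0"
  by (rule nonzero_if_real_eval[of "\<lambda>i. if i = p then 1 else 0"]) (simp add: real_eval_simps)

lemma multiple_var_eq_iff:
  "const_poly (real c) * var_poly l = const_poly (real d) * var_poly l \<longleftrightarrow> c = d"
  by (auto dest: arg_cong[where f = "real_eval (\<lambda>_. 1)"] simp: real_eval_simps)

lemma exists_basis_poly:
  assumes "2 \<le> k" "k \<le> l" "0 < m" "m < l"
  shows "\<exists>F. basis_poly l k m F"
proof (cases "Suc m < k")
  case True
  define F where "F = (\<Prod>i<Suc m. [:- (const_poly (real i) * var_poly l), 1:]) *
    (\<Prod>p\<in>{m<..<l}. [:- rel_var p, 1:])"
  have F: "poly F t = (\<Prod>i<Suc m. t - const_poly (real i) * var_poly l) * (\<Prod>p\<in>{m<..<l}. t - rel_var p)" for t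
    by (simp add: F_def poly_prod algebra_simps)
  have "graded (Suc l) l (poly F t)" if t: "graded (Suc l) 1 t" for t
  proof -
    have "graded (Suc l) (card {..<Suc m} + card {m<..<l}) (poly F t)"
      unfolding F
      by (intro graded_mult graded_prod graded_diff[OF t] graded_const_mult graded_var rel_var_graded) auto
    then show ?thesis using assms by simp
  qed
  moreover have "poly F (const_poly (real c) * var_poly l) = 0" if "c \<le> m" for c
  proof -
    have "(\<Prod>i<Suc m. const_poly (real c) * var_poly l - const_poly (real i) * var_poly l) = 0"
      by (rule prod_zero) (use that in \<open>auto intro!: bexI[of _ c]\<close>)
    then show ?thesis unfolding F by (simp only: mult_zero_left)
  qed
  moreover have "poly F (rel_var p) = 0" if "m < p" "p < l" for p
  proof -
    have "(\<Prod>q\<in>{m<..<l}. rel_var p - rel_var q) = 0"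
      by (rule prod_zero) (use that in \<open>auto intro!: bexI[of _ p]\<close>)
    then show ?thesis unfolding F by (simp only: mult_zero_right)
  qed
  moreover have "poly F (rel_var m) \<noteq> 0"
  proof -
    have "(\<Prod>i<Suc m. rel_var m - const_poly (real i) * var_poly l) \<noteq> 0"
      unfolding prod_zero_iff[OF finite_lessThan] using rel_var_minus_multiple_nonzero assms by blast
    moreover have "(\<Prod>q\<in>{m<..<l}. rel_var m - rel_var q) \<noteq> 0"
      unfolding prod_zero_iff[OF finite_greaterThanLessThan]
      using rel_var_diff_nonzero by (metis greaterThanLessThan_iff less_irrefl)
    ultimately show ?thesis unfolding F by (simp only: mult_eq_0_iff) blast
  qed
  ultimately show ?thesis
    using True unfolding basis_poly_def by (intro exI[of _ F]) simp
next
  case False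
  have len: "Suc (k - 1) + length (shi_roots l k m) = l"
    using assms False by (simp add: shi_roots_def)
  have "\<forall>w\<in>set (shi_roots l k m). graded (Suc l) 1 w"
    using assms by (auto simp: shi_roots_def simp del: One_nat_def intro!: graded_diff graded_var)
  then obtain F where F: "degree F \<le> l" "\<forall>c\<le>k - 1. poly F (const_poly (real c) * var_poly l) = 0"
    "\<forall>t. poly F (t + var_poly l) - poly F t =
             var_poly l * (\<Prod>i<k - 1. t - const_poly (real i) * var_poly l) *
             (\<Prod>w\<leftarrow>shi_roots l k m. t - w)"
    "\<forall>t. graded (Suc l) 1 t \<longrightarrow> graded (Suc l) l (poly F t)"
    using exists_summation_poly[of "shi_roots l k m" "Suc l" "var_poly l" "k - 1", OF _ graded_var]
    unfolding len by blast
  then have "basis_poly l k m F"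
    using False assms unfolding basis_poly_def by (simp add: less_Suc_eq_le[symmetric])
  then show ?thesis ..
qed

lemma dvd_prod_list: "x \<in> set xs \<Longrightarrow> x dvd prod_list xs" for x :: "'a::comm_monoid_mult"
  by (induction xs) (auto intro: dvd_mult)

lemma basis_poly_log_tuple:
  assumes "2 \<le> k" "k \<le> l" "0 < m" "m < l" and F: "basis_poly l k m F"
  shows "log_tuple l k (\<lambda>j. poly F (rel_var j))"
proof -
  have "poly F (const_poly (real 0) * var_poly l) = 0"
    using F assms unfolding basis_poly_def by (metis gr0I le0 less_le_trans numeral_eq_Suc zero_less_Suc)
  then have F0: "poly F (rel_var 0) = 0"
    by simp
  have "form_poly l (i, j, c) dvd poly F (rel_var i) - poly F (rel_var j)"
    if "(i, j, c) \<in> shi_ish_index l k" for i j c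
  proof -
    have ij: "i < j" "j < l"
      and c: "c = 0 \<or> i = 0 \<and> c \<le> j \<and> c < k \<or> c = 1 \<and> k \<le> Suc i"
      using that by (auto simp: shi_ish_index_def)
    from c show ?thesis
    proof (elim disjE)
      assume "c = 0"
      then have "form_poly l (i, j, c) = - (rel_var i - rel_var j)" by simp
      then show ?thesis
        using diff_dvd_poly_diff[of "rel_var i" "rel_var j" F] by (simp only: minus_dvd_iff)
    next
      assume i: "i = 0 \<and> c \<le> j \<and> c < k"
      let ?w = "const_poly (real c) * var_poly l"
      have form: "form_poly l (i, j, c) = rel_var j - ?w" using i by simp
      \<comment> \<open>If F is not known to vanish at c z, then m < c <= j in the Ish range, and
        y_j is itself a root.\<close>
      have "poly F ?w = 0 \<or> poly F (rel_var j) = 0"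
        using F i ij assms unfolding basis_poly_def by (metis le_less_trans not_le)
      then show ?thesis
        unfolding form using i F0 diff_dvd_poly_diff[of "rel_var j" ?w F] by (auto simp: dvd_minus_iff)
    next
      assume i: "c = 1 \<and> k \<le> Suc i"
      let ?d = "rel_var j - (rel_var i + var_poly l)"
      have form: "form_poly l (i, j, c) = ?d" using i by simp
      show ?thesis
      proof (cases "Suc m < k")
        case True
        then have "poly F (rel_var i) = 0" "poly F (rel_var j) = 0"
          using F i ij unfolding basis_poly_def by auto
        then show ?thesis by simp
      next
        \<comment> \<open>Modulo \<open>?d\<close> the values of F at y_j and y_i + z agree, so it
          remains to treat the difference of F at y_i. For i < m the list of roots contains y_i;
          otherwise j > i >= m and it contains y_j - z.\<close>
        case False
        let ?P = "\<Prod>w\<leftarrow>shi_roots l k m. rel_var i - w"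
        have "?d dvd ?P"
        proof (cases "i < m")
          case True
          then have "rel_var i \<in> set (shi_roots l k m)"
            using i by (auto simp: shi_roots_def)
          then have "?P = 0"
            by (force simp: prod_list_zero_iff)
          then show ?thesis by (simp only: dvd_0_right)
        next
          case False
          then have "rel_var j - var_poly l \<in> set (shi_roots l k m)"
            using ij by (auto simp: shi_roots_def)
          then have "rel_var i - (rel_var j - var_poly l) dvd ?P"
            by (intro dvd_prod_list) (simp only: set_map, rule imageI)
          moreover have "rel_var i - (rel_var j - var_poly l) = - ?d" by simp
          ultimately show ?thesis by (simp only: minus_dvd_iff)
        qed
        then have "?d dvd poly F (rel_var i + var_poly l) - poly F (rel_var i)"
          using F False unfolding basis_poly_def by (simp only: if_False dvd_mult)
        moreover have "?d dvd poly F (rel_var j) - poly F (rel_var i + var_poly l)"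
          by (rule diff_dvd_poly_diff)
        ultimately have "?d dvd - (poly F (rel_var j) - poly F (rel_var i + var_poly l) +
            (poly F (rel_var i + var_poly l) - poly F (rel_var i)))"
          by (simp only: dvd_minus_iff dvd_add)
        then show ?thesis
          unfolding form by (simp only: diff_add_cancel add_diff_eq minus_diff_eq)
      qed
    qed
  qed
  then show ?thesis
    using F0 unfolding log_tuple_def by auto
qed

text \<open>Evaluation at y_p with p >= k - 1 sees only the polynomials of the Shi range, and a root
  count kills their combination. Its differences at the y_p, and then the Ish values at the y_m,
  form triangular systems with nonzero diagonal.\<close>

lemma basis_poly_independent:
  assumes kl: "2 \<le> k" "k \<le> l" and F: "\<And>m. 0 < m \<Longrightarrow> m < l \<Longrightarrow> basis_poly l k m (F m)"
    and zero: "\<And>j. 0 < j \<Longrightarrow> j < l \<Longrightarrow> (\<Sum>m\<in>{1..<l}. v m * poly (F m) (rel_var j)) = 0"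
    and m: "0 < m" "m < l"
  shows "v m = 0"
proof -
  let ?z = "var_poly l"
  have ish_zero: "poly (F m) (rel_var j) = 0" if "0 < m" "Suc m < k" "m < j" "j < l" for m j
    using F[of m] that unfolding basis_poly_def by auto
  have shi: "degree (F m) \<le> l" "\<And>c. c < k \<Longrightarrow> poly (F m) (const_poly (real c) * ?z) = 0"
    "\<And>t. poly (F m) (t + ?z) - poly (F m) t =
       ?z * (\<Prod>i<k - 1. t - const_poly (real i) * ?z) * (\<Prod>w\<leftarrow>shi_roots l k m. t - w)"
    if "0 < m" "k - 1 \<le> m" "m < l" for m
    using F[of m] that kl unfolding basis_poly_def by (auto split: if_splits)
  define G where "G = (\<Sum>m\<in>{k - 1..<l}. smult (v m) (F m))"
  have poly_G: "poly G t = (\<Sum>m\<in>{k - 1..<l}. v m * poly (F m) t)" for t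
    by (simp add: G_def poly_sum)
  have "G = 0"
  proof (rule ccontr)
    assume "G \<noteq> 0"
    let ?R = "(\<lambda>c. const_poly (real c) * ?z) ` {..<k} \<union> rel_var ` {k - 1..<l}"
    have "poly G x = 0" if "x \<in> ?R" for x
      using that
    proof
      assume "x \<in> (\<lambda>c. const_poly (real c) * ?z) ` {..<k}"
      then show ?thesis
        unfolding poly_G using shi(2) kl by (auto intro!: sum.neutral)
    next
      assume "x \<in> rel_var ` {k - 1..<l}"
      then obtain j where j: "x = rel_var j" "k - 1 \<le> j" "j < l" by auto
      have "(\<Sum>m\<in>{1..<l}. v m * poly (F m) x) = (\<Sum>m\<in>{k - 1..<l}. v m * poly (F m) x)"
        by (rule sum.mono_neutral_right) (use kl j ish_zero in auto)
      then show ?thesis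
        unfolding poly_G using zero[of j] j kl by simp
    qed
    then have "?R \<subseteq> {x. poly G x = 0}"
      by blast
    then have "card ?R \<le> degree G"
      using card_mono[OF poly_roots_finite[OF \<open>G \<noteq> 0\<close>]] card_poly_roots_bound[OF \<open>G \<noteq> 0\<close>] order.trans
      by blast
    also have "degree G \<le> l"
      unfolding G_def
    proof (rule degree_sum_le)
      fix m assume "m \<in> {k - 1..<l}"
      then show "degree (smult (v m) (F m)) \<le> l"
        using shi(1)[of m] kl degree_smult_le[of "v m" "F m"] by fastforce
    qed simp
    finally have "card ?R \<le> l" .
    \<comment> \<open>This is l + 1: the k multiples of z and the l - k + 1 elements y_p.\<close>
    moreover have "card ?R = k + (l - (k - 1))"
    proof -
      have "inj_on (\<lambda>c. const_poly (real c) * ?z) {..<k}"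
        using multiple_var_eq_iff by (auto simp: inj_on_def)
      moreover have "inj_on rel_var {k - 1..<l}"
        using rel_var_diff_nonzero by (force simp: inj_on_def)
      moreover have "(\<lambda>c. const_poly (real c) * ?z) ` {..<k} \<inter> rel_var ` {k - 1..<l} = {}"
      proof -
        have "const_poly (real c) * ?z \<noteq> rel_var j" if "j \<in> {k - 1..<l}" for c j
        proof -
          have "0 < j" "j < l" using that kl by auto
          then show ?thesis using rel_var_minus_multiple_nonzero[of j l c] by auto
        qed
        then show ?thesis by blast
      qed
      ultimately show ?thesis
        by (simp add: card_Un_disjoint card_image)
    qed
    ultimately show False using kl by simp
  qed
  have shi_v: "v p = 0" if "k - 1 \<le> p" "p < l" for p
    using that
  proof (induction p rule: less_induct)
    case (less p)
    let ?H = "\<lambda>m. \<Prod>w\<leftarrow>shi_roots l k m. rel_var p - w"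
    let ?C = "?z * (\<Prod>i<k - 1. rel_var p - const_poly (real i) * ?z)"
    \<comment> \<open>In the difference at y_p the terms with m > p vanish because y_p is one of
      their roots, those with m < p by induction.\<close>
    have "poly G (rel_var p + ?z) - poly G (rel_var p) = 0"
      using \<open>G = 0\<close> by simp
    then have "(\<Sum>m\<in>{k - 1..<l}. v m * (poly (F m) (rel_var p + ?z) - poly (F m) (rel_var p))) = 0"
      by (simp only: poly_G right_diff_distrib sum_subtractf)
    also have "(\<Sum>m\<in>{k - 1..<l}. v m * (poly (F m) (rel_var p + ?z) - poly (F m) (rel_var p))) =
        (\<Sum>m\<in>{k - 1..<l}. v m * (?C * ?H m))"
      by (rule sum.cong) (use shi(3) kl in auto)
    also have "\<dots> = v p * (?C * ?H p)"
    proof (rule sum.mono_neutral_right[where S = "{p}", THEN trans])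
      show "\<forall>m\<in>{k - 1..<l} - {p}. v m * (?C * ?H m) = 0"
      proof
        fix m assume m: "m \<in> {k - 1..<l} - {p}"
        show "v m * (?C * ?H m) = 0"
        proof (cases "m < p")
          case True
          then show ?thesis using less m by simp
        next
          case False
          then have "rel_var p \<in> set (shi_roots l k m)"
            using m less.prems by (auto simp: shi_roots_def)
          then have "?H m = 0" by (force simp: prod_list_zero_iff)
          then show ?thesis by simp
        qed
      qed
    qed (use less.prems in auto)
    finally have "v p * (?C * ?H p) = 0" .
    moreover have "?C \<noteq> 0"
      using rel_var_minus_multiple_nonzero[of p l] less.prems kl by (simp add: prod_zero_iff)
    moreover have "?H p \<noteq> 0"
      unfolding prod_list_zero_iff shi_roots_def
      using rel_var_diff_nonzero[of p] rel_var_diff_nonzero'[of p l] less.prems by auto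
    ultimately show ?case by simp
  qed
  show ?thesis
  proof (rule ccontr)
    assume "v m \<noteq> 0"
    let ?S = "{m. 0 < m \<and> m < l \<and> v m \<noteq> 0}"
    \<comment> \<open>The largest index with nonzero coefficient lies in the Ish range, and every
      F_m with m < M vanishes at y_M, which isolates \<open>v M\<close>.\<close>
    define M where "M = Max ?S"
    have fin: "finite ?S" by simp
    have "M \<in> ?S"
      unfolding M_def by (rule Max_in[OF fin]) (use \<open>v m \<noteq> 0\<close> m in auto)
    then have M: "0 < M" "M < l" "v M \<noteq> 0" by auto
    then have "Suc M < k" using shi_v[of M] by fastforce
    have "v m' = 0" if "M < m'" "m' < l" for m'
      using Max_ge[OF fin, of m'] that M unfolding M_def[symmetric] by fastforce
    moreover have "poly (F m') (rel_var M) = 0" if "0 < m'" "m' < M" for m'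
      using ish_zero[of m' M] that M \<open>Suc M < k\<close> by simp
    ultimately have "\<forall>m'\<in>{1..<l} - {M}. v m' * poly (F m') (rel_var M) = 0"
      using M by (auto simp: neq_iff)
    then have "(\<Sum>m\<in>{1..<l}. v m * poly (F m) (rel_var M)) = (\<Sum>m\<in>{M}. v m * poly (F m) (rel_var M))"
      using M by (intro sum.mono_neutral_right) auto
    then have "v M * poly (F M) (rel_var M) = 0"
      using zero[of M] M by simp
    moreover have "poly (F M) (rel_var M) \<noteq> 0"
      using F[of M] M \<open>Suc M < k\<close> unfolding basis_poly_def by simp
    ultimately show False using M by simp
  qed
qed

text \<open>Independence of the columns makes the determinant nonzero, and the product of the forms
  divides it. Both have degree l (l - 1), so the cofactor is invariant under doubling the variables
  and hence constant.\<close>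

lemma basis_det:
  assumes kl: "2 \<le> k" "k \<le> l" and F: "\<And>m. 0 < m \<Longrightarrow> m < l \<Longrightarrow> basis_poly l k m (F m)"
  obtains r where "r \<noteq> 0"
    "det (mat (l - 1) (l - 1) (\<lambda>(a, m). poly (F (Suc m)) (rel_var (Suc a)))) =
      const_poly r * (\<Prod>t\<in>shi_ish_index l k. form_poly l t)"
proof -
  let ?A = "mat (l - 1) (l - 1) (\<lambda>(a, m). poly (F (Suc m)) (rel_var (Suc a)))"
  let ?Q = "\<Prod>t\<in>shi_ish_index l k. form_poly l t"
  have "?Q dvd det ?A"
  proof (rule prod_form_poly_dvd_det[OF kl(1)])
    fix m assume "m < l - 1"
    then show "log_tuple l k (\<lambda>j. poly (F (Suc m)) (rel_var j))"
      using basis_poly_log_tuple[OF kl _ _ F[of "Suc m"]] by simp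
  qed
  then obtain q where q: "det ?A = ?Q * q"
    by (rule dvdE)
  have "det ?A \<noteq> 0"
  proof
    assume "det ?A = 0"
    then obtain v where v: "v \<in> carrier_vec (l - 1)" "v \<noteq> 0\<^sub>v (l - 1)" "?A *\<^sub>v v = 0\<^sub>v (l - 1)"
      using det_0_iff_vec_prod_zero[of ?A "l - 1"] by auto
    have v_zero: "(\<Sum>m\<in>{1..<l}. v $ (m - 1) * poly (F m) (rel_var j)) = 0" if j: "0 < j" "j < l" for j
    proof -
      have "(?A *\<^sub>v v) $ (j - 1) = 0"
        unfolding v(3) using j by simp
      then have "(\<Sum>m\<in>{0..<l - 1}. poly (F (Suc m)) (rel_var j) * v $ m) = 0"
        using j v(1) by (simp add: scalar_prod_def)
      moreover have "(\<Sum>m\<in>{1..<l}. v $ (m - 1) * poly (F m) (rel_var j)) =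
          (\<Sum>m\<in>{0..<l - 1}. v $ m * poly (F (Suc m)) (rel_var j))"
        using sum.atLeast_Suc_lessThan_Suc_shift[of "\<lambda>m. v $ (m - 1) * poly (F m) (rel_var j)" 0 "l - 1"] kl
        by simp
      ultimately show ?thesis
        by (simp add: mult.commute)
    qed
    have "v $ (m - 1) = 0" if "0 < m" "m < l" for m
      by (rule basis_poly_independent[where v = "\<lambda>m. v $ (m - 1)", OF kl F v_zero that])
    from this[of "Suc _"] have "v $ a = 0" if "a < l - 1" for a
      using that by simp
    then have "v = 0\<^sub>v (l - 1)"
      using v(1) by auto
    then show False
      using v(2) by simp
  qed
  interpret comm_ring_hom double_vars
    by (rule subst_mpoly_hom)
  have "map_mat double_vars ?A = (const_poly 2 ^ l) \<cdot>\<^sub>m ?A"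
  proof (rule eq_matI, goal_cases)
    case (1 a m)
    then have "graded (Suc l) l (poly (F (Suc m)) (rel_var (Suc a)))"
      using F[of "Suc m"] rel_var_graded[of "Suc a" "Suc l"] unfolding basis_poly_def by simp
    then show ?case
      using 1 by (simp add: graded_def)
  qed simp_all
  then have "double_vars (det ?A) = const_poly 2 ^ (l * (l - 1)) * det ?A"
    unfolding hom_det[symmetric] by (simp add: power_mult)
  moreover have "graded (Suc l) (l * (l - 1)) ?Q"
    unfolding card_shi_ish_index(2)[OF kl(1), symmetric]
  proof (rule graded_prod[OF card_shi_ish_index(1)[OF kl(1)]])
    fix t assume "t \<in> shi_ish_index l k"
    then obtain i j c where "t = (i, j, c)" "i < l" "j < l"
      by (auto simp: shi_ish_index_def)
    then show "graded (Suc l) 1 (form_poly l t)"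
      by (simp del: One_nat_def) (intro graded_diff graded_const_mult graded_var; simp)
  qed
  then have "double_vars ?Q = const_poly 2 ^ (l * (l - 1)) * ?Q"
    by (simp add: graded_def)
  ultimately have "const_poly 2 ^ (l * (l - 1)) * ?Q * double_vars q = const_poly 2 ^ (l * (l - 1)) * ?Q * q"
    unfolding q subst_mpoly_simps by (simp only: mult.assoc)
  moreover have "const_poly 2 ^ (l * (l - 1)) * ?Q \<noteq> 0"
    using \<open>det ?A \<noteq> 0\<close> unfolding q by auto
  ultimately have "double_vars q = q"
    using mult_left_cancel by blast
  then obtain r where "q = const_poly r"
    by (rule double_vars_fixed_imp_const)
  then show ?thesis
    using that[of r] q \<open>det ?A \<noteq> 0\<close> by (auto simp: mult.commute)
qed

lemma free_cone_shi_ish: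
  assumes kl: "2 \<le> k" "k \<le> l"
  shows "free_with_exponents (Suc l) (cone_arrangement l (shi_ish l k)) ({#0, 1#} + replicate_mset (l - 1) l)"
proof -
  let ?N = "Suc l" and ?L = "log_derivations (Suc l) (cone_arrangement l (shi_ish l k))"
  obtain F where F: "\<And>m. 0 < m \<Longrightarrow> m < l \<Longrightarrow> basis_poly l k m (F m)"
    using exists_basis_poly[OF kl] by metis
  obtain r where r: "r \<noteq> 0" "det (mat (l - 1) (l - 1) (\<lambda>(a, m). poly (F (Suc m)) (rel_var (Suc a)))) =
      const_poly r * (\<Prod>t\<in>shi_ish_index l k. form_poly l t)"
    by (rule basis_det[where F = F, OF kl F])
  have gradedF: "graded ?N l (poly (F m) (rel_var p))" if "0 < m" "m < l" "p < l" for m p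
    using F[OF that(1,2)] rel_var_graded[of p ?N] that unfolding basis_poly_def by simp
  have logF: "log_tuple l k (\<lambda>j. poly (F m) (rel_var j))" if "0 < m" "m < l" for m
    using basis_poly_log_tuple[OF kl that] F[OF that] by blast
  \<comment> \<open>The value of the i-th basis derivation at coordinate p, where p = l is z: first
    the sum of the partial derivatives in the x_p, then the Euler derivation, then the F_m with i =
    m + 1.\<close>
  define f where "f i p = (if i = 0 then (if p < l then 1 else 0) else if i = 1 then var_poly p
      else if p < l then poly (F (i - 1)) (rel_var p) else 0)" for i p
  define ds where "ds = 0 # 1 # replicate (l - 1) l"
  define \<theta>s where "\<theta>s = map (\<lambda>i. derivation_of ?N (f i)) [0..<?N]"
  have len: "length \<theta>s = ?N" "length ds = ?N"
    using kl by (simp_all add: \<theta>s_def ds_def)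
  have nth: "\<theta>s ! i = derivation_of ?N (f i)" if "i < ?N" for i
    using that by (simp add: \<theta>s_def del: upt_Suc)
  have graded_f: "graded ?N (ds ! i) (f i p)" if "i < ?N" "p < ?N" for i p
  proof -
    consider "i = 0" | "i = 1" | m where "i = Suc m" "0 < m" "m < l"
      using \<open>i < ?N\<close> by (metis One_nat_def Suc_less_eq neq0_conv not0_implies_Suc)
    then show ?thesis
    proof cases
      case 3
      then have "ds ! i = l"
        by (simp add: ds_def nth_Cons' )
      then show ?thesis
        using 3 gradedF by (auto simp: f_def graded_zero)
    qed (use that graded_const[of ?N 1] graded_var[of p ?N] graded_zero[of ?N] in \<open>auto simp: f_def ds_def\<close>)
  qed
  have der: "\<theta>s ! i \<in> derivations ?N" if "i < ?N" for i
    unfolding nth[OF that]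
    by (rule derivation_of_in_derivations) (use graded_f[OF that] in \<open>simp add: graded_def\<close>)
  have val: "(\<theta>s ! i) (var_poly p) = f i p" if "i < ?N" "p < ?N" for i p
    using that by (simp add: nth derivation_of_var)
  have in_log: "\<theta>s ! i \<in> ?L" if i: "i < ?N" for i
    unfolding log_derivations_shi_ish[OF kl(1)]
  proof (intro conjI ballI)
    show "\<theta>s ! i \<in> derivations ?N" by (rule der[OF i])
    show "var_poly l dvd (\<theta>s ! i) (var_poly l)"
      by (simp add: val[OF i] f_def)
    fix t assume t: "t \<in> shi_ish_index l k"
    obtain a b c where abc: "t = (a, b, c)" "a < b" "b < l"
      using t by (auto simp: shi_ish_index_def)
    have "form_poly l (a, b, c) dvd f i a - f i b - const_poly (real c) * f i l"
    proof -
      consider "i = 0" | "i = 1" | m where "i = Suc m" "0 < m" "m < l"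
        using i by (metis One_nat_def Suc_less_eq neq0_conv not0_implies_Suc)
      then show ?thesis
      proof cases
        case 3
        then show ?thesis
          using logF[of m] t abc unfolding log_tuple_def by (auto simp: f_def)
      qed (use abc in \<open>auto simp: f_def\<close>)
    qed
    then show "case t of (a, b, c) \<Rightarrow> form_poly l (a, b, c) dvd
        (\<theta>s ! i) (var_poly a) - (\<theta>s ! i) (var_poly b) - const_poly (real c) * (\<theta>s ! i) (var_poly l)"
      using abc by (simp add: val[OF i])
  qed
  have split: "(\<Sum>i<?N. g i * f i p) = g 0 * f 0 p + g 1 * f 1 p + (\<Sum>m<l - 1. g (Suc (Suc m)) * f (Suc (Suc m)) p)"
    for g :: "nat \<Rightarrow> real_mpoly" and p
  proof -
    obtain l' where l': "l = Suc l'"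
      using kl by (cases l) auto
    show ?thesis
      unfolding l' by (simp only: sum.lessThan_Suc_shift) (simp add: algebra_simps)
  qed
  have "module_basis ?N ?L \<theta>s"
    unfolding module_basis_def len
  proof (intro conjI ballI impI allI)
    show "set \<theta>s \<subseteq> ?L"
      using in_log len by (metis in_set_conv_nth subsetI)
  next
    fix \<theta> assume "\<theta> \<in> ?L"
    then have \<theta>: "\<theta> \<in> derivations ?N" "var_poly l dvd \<theta> (var_poly l)"
      "\<And>i j c. (i, j, c) \<in> shi_ish_index l k \<Longrightarrow> form_poly l (i, j, c) dvd
         \<theta> (var_poly i) - \<theta> (var_poly j) - const_poly (real c) * \<theta> (var_poly l)"
      unfolding log_derivations_shi_ish[OF kl(1)] by auto
    have ring: "\<theta> (var_poly p) \<in> poly_ring ?N" if "p < ?N" for p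
      using derivations_closed[OF \<theta>(1)] that by simp
    obtain b where b: "b \<in> poly_ring ?N" "\<theta> (var_poly l) = var_poly l * b"
      using \<theta>(2) by (rule poly_ring_dvdE) (use ring in auto)
    \<comment> \<open>The Euler coefficient \<open>b\<close> was read off at z, the coefficient
      \<open>e\<close> of the sum of partial derivatives is read off at x_0; what remains on the x_p
      is a logarithmic tuple.\<close>
    define e where "e = \<theta> (var_poly 0) - b * var_poly 0"
    define u where "u p = \<theta> (var_poly p) - b * var_poly p - e" for p
    have u: "log_tuple l k u"
      unfolding log_tuple_def
    proof (intro conjI ballI)
      show "u 0 = 0" by (simp add: u_def e_def)
      fix t assume "t \<in> shi_ish_index l k"
      moreover obtain i j c where t: "t = (i, j, c)" by (cases t)
      ultimately have "form_poly l (i, j, c) dvd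
          (\<theta> (var_poly i) - \<theta> (var_poly j) - const_poly (real c) * \<theta> (var_poly l)) - form_poly l (i, j, c) * b"
        using dvd_diff[OF \<theta>(3) dvd_triv_left] by blast
      also have "\<dots> = u i - u j"
        by (simp add: u_def b algebra_simps)
      finally show "case t of (i, j, c) \<Rightarrow> form_poly l (i, j, c) dvd u i - u j"
        by (simp add: t)
    qed
    have e_ring: "e \<in> poly_ring ?N"
      using ring b(1) kl by (simp add: e_def)
    have u_ring: "u p \<in> poly_ring ?N" if "p < l" for p
      using ring b(1) e_ring that by (simp add: u_def)
    have log_g: "log_tuple l k (\<lambda>j. poly (F (Suc m)) (rel_var j))" if "m < l - 1" for m
      using logF[of "Suc m"] that by simp
    have g_ring: "poly (F (Suc m)) (rel_var j) \<in> poly_ring ?N" if "m < l - 1" "j < l" for m j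
      using gradedF[of "Suc m" j] that by (simp add: graded_def)
    obtain q where q: "\<And>m. m < l - 1 \<Longrightarrow> q m \<in> poly_ring ?N"
      "\<And>j. j < l \<Longrightarrow> u j = (\<Sum>m<l - 1. q m * poly (F (Suc m)) (rel_var j))"
      by (rule log_tuple_generated[where g = "\<lambda>m j. poly (F (Suc m)) (rel_var j)",
            OF kl(1) u log_g r(2,1) u_ring g_ring]) auto
    define g where "g i = (if i = 0 then e else if i = 1 then b else q (i - 2))" for i
    have g: "g \<in> {..<?N} \<rightarrow> poly_ring ?N"
      using q(1) b(1) e_ring by (auto simp: g_def)
    have "\<theta> p = (\<Sum>i<?N. g i * (\<theta>s ! i) p)" if "p \<in> poly_ring ?N" for p
    proof (rule derivation_on_unique[OF _ _ _ that])
      show "derivation_on ?N \<theta>"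
        by (rule derivations_imp_derivation_on[OF \<theta>(1)])
      show "derivation_on ?N (\<lambda>p. \<Sum>i<?N. g i * (\<theta>s ! i) p)"
        by (rule derivation_on_sum) (use der derivations_imp_derivation_on in auto)
      fix p assume p: "p < ?N"
      have "(\<Sum>i<?N. g i * (\<theta>s ! i) (var_poly p)) = (\<Sum>i<?N. g i * f i p)"
        using val p by (intro sum.cong) auto
      also have "\<dots> = e * f 0 p + b * var_poly p + (\<Sum>m<l - 1. q m * f (Suc (Suc m)) p)"
        unfolding split by (simp add: g_def f_def)
      also have "\<dots> = \<theta> (var_poly p)"
      proof (cases "p < l")
        case True
        then have "(\<Sum>m<l - 1. q m * f (Suc (Suc m)) p) = u p"
          by (simp add: q f_def)
        then show ?thesis
          using True by (simp add: f_def u_def)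
      next
        case False
        then have "p = l" using p by simp
        then show ?thesis
          by (simp add: f_def b)
      qed
      finally show "\<theta> (var_poly p) = (\<Sum>i<?N. g i * (\<theta>s ! i) (var_poly p))" ..
    qed
    then show "\<exists>g\<in>{..<?N} \<rightarrow> poly_ring ?N. \<forall>p\<in>poly_ring ?N. \<theta> p = (\<Sum>i<?N. g i * (\<theta>s ! i) p)"
      using g by blast
  next
    fix g i
    assume zero: "\<forall>p\<in>poly_ring ?N. (\<Sum>i<?N. g i * (\<theta>s ! i) p) = 0" and i: "i < ?N"
    have eq: "g 0 * f 0 p + g 1 * var_poly p + (\<Sum>m<l - 1. g (Suc (Suc m)) * f (Suc (Suc m)) p) = 0"
      if "p < ?N" for p
    proof -
      have "(\<Sum>i<?N. g i * f i p) = (\<Sum>i<?N. g i * (\<theta>s ! i) (var_poly p))"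
        using val that by (intro sum.cong) auto
      also have "\<dots> = 0"
        using zero that by simp
      finally show ?thesis
        unfolding split by (simp add: f_def)
    qed
    \<comment> \<open>At z only the Euler derivation is nonzero, at x_0 only the first two
      derivations are; the other coefficients fall under
      \<open>basis_poly_independent\<close>.\<close>
    have g1: "g 1 = 0"
      using eq[of l] by (simp add: f_def)
    have "poly (F (Suc m)) (rel_var 0) = 0" if "m < l - 1" for m
      using logF[of "Suc m"] that unfolding log_tuple_def by simp
    then have g0: "g 0 = 0"
      using eq[of 0] g1 kl by (simp add: f_def)
    have g_zero: "(\<Sum>m\<in>{1..<l}. g (Suc m) * poly (F m) (rel_var j)) = 0" if j: "0 < j" "j < l" for j
    proof -
      have "(\<Sum>m\<in>{1..<l}. g (Suc m) * poly (F m) (rel_var j)) =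
          (\<Sum>m\<in>{0..<l - 1}. g (Suc (Suc m)) * poly (F (Suc m)) (rel_var j))"
        using sum.atLeast_Suc_lessThan_Suc_shift[of "\<lambda>m. g (Suc m) * poly (F m) (rel_var j)" 0 "l - 1"] kl
        by simp
      also have "\<dots> = 0"
        using eq[of j] g0 g1 j by (simp add: f_def atLeast0LessThan)
      finally show ?thesis .
    qed
    have "g (Suc m) = 0" if "0 < m" "m < l" for m
      by (rule basis_poly_independent[where v = "\<lambda>m. g (Suc m)", OF kl F g_zero that])
    then show "g i = 0"
      using g0 g1 i by (metis One_nat_def Suc_less_eq neq0_conv not0_implies_Suc)
  qed
  moreover have "homogeneous_derivation ?N (ds ! i) (\<theta>s ! i)" if "i < ?N" for i
    unfolding homogeneous_derivation_def
    by (auto simp: val[OF that] intro!: graded_imp_homogeneous graded_f[OF that])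
  moreover have "mset ds = {#0, 1#} + replicate_mset (l - 1) l"
    by (simp add: ds_def)
  ultimately show ?thesis
    unfolding free_with_exponents_def using len by blast
qed


section \<open>Supersolvability of the Ish arrangement\<close>

lemma maxchain_memI:
  assumes "pred_on.maxchain L (\<lambda>X Y. Y \<subset> X) C" "Z \<in> L" "\<And>X. X \<in> C \<Longrightarrow> X \<subseteq> Z \<or> Z \<subseteq> X"
  shows "Z \<in> C"
proof -
  have "pred_on.chain L (\<lambda>X Y. Y \<subset> X) (insert Z C)"
    using assms unfolding pred_on.maxchain_def pred_on.chain_def by auto
  then show ?thesis
    using assms(1) unfolding pred_on.maxchain_def by (metis insertI1 psubsetI subset_insertI)
qed

lemma maxchain_subset: "pred_on.maxchain L (\<lambda>X Y. Y \<subset> X) C \<Longrightarrow> C \<subseteq> L"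
  by (simp add: pred_on.maxchain_def pred_on.chain_def)

lemma maxchain_comparable:
  "pred_on.maxchain L (\<lambda>X Y. Y \<subset> X) C \<Longrightarrow> X \<in> C \<Longrightarrow> Y \<in> C \<Longrightarrow> X \<subseteq> Y \<or> Y \<subseteq> X"
  unfolding pred_on.maxchain_def pred_on.chain_def by blast

definition linear_set :: "nat \<Rightarrow> real vec set \<Rightarrow> bool" where
  "linear_set n X \<longleftrightarrow> X \<subseteq> carrier_vec n \<and> 0\<^sub>v n \<in> X \<and>
     (\<forall>x\<in>X. \<forall>y\<in>X. x + y \<in> X) \<and> (\<forall>x\<in>X. \<forall>c. c \<cdot>\<^sub>v x \<in> X)"

lemma linear_set_diff: "linear_set n X \<Longrightarrow> x \<in> X \<Longrightarrow> y \<in> X \<Longrightarrow> x - c \<cdot>\<^sub>v y \<in> X"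
proof -
  assume X: "linear_set n X" "x \<in> X" "y \<in> X"
  then have "x + (- c) \<cdot>\<^sub>v y \<in> X"
    by (simp add: linear_set_def)
  moreover have "x + (- c) \<cdot>\<^sub>v y = x - c \<cdot>\<^sub>v y"
    using X by (intro eq_vecI) (auto simp: linear_set_def)
  ultimately show ?thesis by simp
qed

lemma linear_set_cone: "H \<in> cone_arrangement l (shi_ish l k) \<Longrightarrow> 2 \<le> k \<Longrightarrow> linear_set (Suc l) H"
  unfolding cone_shi_ish
  by (auto simp: linear_set_def infinity_hyperplane_def cone_hyperplane_def shi_ish_index_def algebra_simps)

lemma linear_set_lattice:
  assumes "\<And>H. H \<in> A \<Longrightarrow> linear_set n H" "X \<in> intersection_lattice n A"
  shows "linear_set n X"
proof -
  obtain B where "X = carrier_vec n \<inter> \<Inter>B" "B \<subseteq> A"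
    using assms(2) by (auto simp: intersection_lattice_def)
  moreover from this have "0\<^sub>v n \<in> H" "\<And>x y. x \<in> H \<Longrightarrow> y \<in> H \<Longrightarrow> x + y \<in> H"
    "\<And>x c. x \<in> H \<Longrightarrow> c \<cdot>\<^sub>v x \<in> H" if "H \<in> B" for H
    using assms(1)[of H] that unfolding linear_set_def by blast+
  ultimately show ?thesis
    unfolding linear_set_def by auto
qed

lemma lattice_Int:
  assumes "X \<in> intersection_lattice n A" "H \<in> A"
  shows "X \<inter> H \<in> intersection_lattice n A"
proof -
  obtain B where "X = carrier_vec n \<inter> \<Inter>B" "B \<subseteq> A"
    using assms(1) by (auto simp: intersection_lattice_def)
  then have "X \<inter> H = carrier_vec n \<inter> \<Inter>(insert H B)" "insert H B \<subseteq> A"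
    using assms(2) by auto
  then show ?thesis
    unfolding intersection_lattice_def by blast
qed

lemma lattice_carrier: "carrier_vec n \<in> intersection_lattice n A"
  unfolding intersection_lattice_def by (auto intro: exI[of _ "{}"])

lemma lattice_eq_closure:
  assumes "X \<in> intersection_lattice n A"
  shows "X = carrier_vec n \<inter> \<Inter>{H \<in> A. X \<subseteq> H}"
  using assms unfolding intersection_lattice_def by blast

text \<open>Coordinates modulo the line of constant vectors: \<open>z\<close> first, then \<open>x\<^sub>0 - x\<^sub>j\<close> for decreasing
  \<open>j\<close>. In this order every pair of hyperplanes involving the last coordinate meets inside a hyperplane
  involving only earlier ones.\<close>

definition coord :: "nat \<Rightarrow> nat \<Rightarrow> real vec \<Rightarrow> real" where
  "coord l s x = (if s = 0 then x $ l else x $ 0 - x $ (l - s))"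

text \<open>\<open>flag l 0\<close> is the whole space; for l > 0, \<open>flag l l\<close> is the
  line of vectors with z = 0 and all x_i equal.\<close>

definition flag :: "nat \<Rightarrow> nat \<Rightarrow> real vec set" where
  "flag l r = {x \<in> carrier_vec (Suc l). \<forall>s<r. coord l s x = 0}"

lemma coord_add: "x \<in> carrier_vec (Suc l) \<Longrightarrow> y \<in> carrier_vec (Suc l) \<Longrightarrow> coord l s (x + y) = coord l s x + coord l s y"
  by (auto simp: coord_def)

lemma coord_minus: "x \<in> carrier_vec (Suc l) \<Longrightarrow> y \<in> carrier_vec (Suc l) \<Longrightarrow> coord l s (x - y) = coord l s x - coord l s y"
  by (auto simp: coord_def)

lemma coord_smult: "x \<in> carrier_vec (Suc l) \<Longrightarrow> coord l s (c \<cdot>\<^sub>v x) = c * coord l s x"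
  by (auto simp: coord_def algebra_simps)

lemma change_coord:
  assumes "x \<in> carrier_vec (Suc l)" "s < l"
  obtains x' where "x' \<in> carrier_vec (Suc l)" "coord l s x' = t"
    "\<And>a. a < l \<Longrightarrow> a \<noteq> s \<Longrightarrow> coord l a x' = coord l a x"
proof (cases "s = 0")
  case True
  show ?thesis
    by (rule that[of "vec (Suc l) (\<lambda>p. if p = l then t else x $ p)"])
       (use assms True in \<open>auto simp: coord_def\<close>)
next
  case False
  show ?thesis
    by (rule that[of "vec (Suc l) (\<lambda>p. if p = l - s then x $ 0 - t else x $ p)"])
       (use assms False in \<open>auto simp: coord_def\<close>)
qed

text \<open>\<open>x\<close> satisfies every equation of an Ish hyperplane that holds on \<open>Y\<close> and involves only the
  first \<open>s\<close> coordinates.\<close>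

definition satisfies_prefix :: "nat \<Rightarrow> real vec set \<Rightarrow> nat \<Rightarrow> real vec \<Rightarrow> bool" where
  "satisfies_prefix l Y s x \<longleftrightarrow>
     (0 < s \<and> (\<forall>y\<in>Y. coord l 0 y = 0) \<longrightarrow> coord l 0 x = 0) \<and>
     (\<forall>a c. 0 < a \<and> a < s \<and> c \<le> l - a \<and> (\<forall>y\<in>Y. coord l a y = real c * coord l 0 y) \<longrightarrow>
        coord l a x = real c * coord l 0 x) \<and>
     (\<forall>a b. 0 < b \<and> b < a \<and> a < s \<and> (\<forall>y\<in>Y. coord l a y = coord l b y) \<longrightarrow> coord l a x = coord l b x)"

text \<open>Every equation on Y whose last coordinate is s prescribes a value for that coordinate.
  Eliminating it from two of them leaves an equation in earlier coordinates that holds on Y and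
  hence at x, so the prescribed values agree.\<close>

lemma satisfies_prefix_Suc:
  assumes s: "s < l" and x: "x \<in> carrier_vec (Suc l)" and sat: "satisfies_prefix l Y s x"
  obtains x' where "x' \<in> carrier_vec (Suc l)" "satisfies_prefix l Y (Suc s) x'"
    "\<And>a. a < s \<Longrightarrow> coord l a x' = coord l a x"
proof (cases "s = 0")
  case True
  show ?thesis
    by (rule change_coord[OF x s, of 0])
       (rule that, use True in \<open>auto simp: satisfies_prefix_def\<close>)
next
  case False
  have inf: "coord l 0 x = 0" if "\<forall>y\<in>Y. coord l 0 y = 0"
    using sat that False unfolding satisfies_prefix_def by blast
  have mul: "coord l a x = real c * coord l 0 x"
    if "0 < a" "a < s" "c \<le> l - a" "\<forall>y\<in>Y. coord l a y = real c * coord l 0 y" for a c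
    using sat that unfolding satisfies_prefix_def by blast
  have eq: "coord l a x = coord l b x" if "0 < b" "0 < a" "b < s" "a < s" "\<forall>y\<in>Y. coord l a y = coord l b y" for a b
  proof -
    have "\<forall>y\<in>Y. coord l b y = coord l a y"
      using that(5) by simp
    then show ?thesis
      using sat that unfolding satisfies_prefix_def by (metis linorder_neqE_nat)
  qed
  \<comment> \<open>The set of prescribed values; if it is empty, any value will do.\<close>
  define T where "T = {real c * coord l 0 x | c. c \<le> l - s \<and> (\<forall>y\<in>Y. coord l s y = real c * coord l 0 y)} \<union>
    {coord l b x | b. 0 < b \<and> b < s \<and> (\<forall>y\<in>Y. coord l s y = coord l b y)}"
  have mul_mul: "real c * coord l 0 x = real c' * coord l 0 x"
    if "\<forall>y\<in>Y. coord l s y = real c * coord l 0 y" "\<forall>y\<in>Y. coord l s y = real c' * coord l 0 y" for c c'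
  proof (cases "c = c'")
    case False
    then have "\<forall>y\<in>Y. coord l 0 y = 0"
      using that by (metis mult_cancel_right of_nat_eq_iff)
    then show ?thesis using inf by simp
  qed simp
  \<comment> \<open>As b < s, the bound c <= l - s implies c <= l - b, so the equation left by
    elimination belongs to the arrangement. This is where the order of the coordinates
    enters.\<close>
  have mul_eq: "coord l b x = real c * coord l 0 x"
    if "c \<le> l - s" "\<forall>y\<in>Y. coord l s y = real c * coord l 0 y"
      "0 < b" "b < s" "\<forall>y\<in>Y. coord l s y = coord l b y" for b c
    using mul[of b c] that by simp
  have eq_eq: "coord l a x = coord l b x"
    if "0 < a" "a < s" "\<forall>y\<in>Y. coord l s y = coord l a y"
      "0 < b" "b < s" "\<forall>y\<in>Y. coord l s y = coord l b y" for a b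
    using eq[of b a] that by simp
  have "t = t'" if "t \<in> T" "t' \<in> T" for t t'
    using that mul_mul mul_eq eq_eq unfolding T_def by (elim UnE CollectE exE conjE) metis+
  then obtain t where t: "\<And>t'. t' \<in> T \<Longrightarrow> t' = t"
    by (metis)
  obtain x' where x': "x' \<in> carrier_vec (Suc l)" "coord l s x' = t"
    "\<And>a. a < l \<Longrightarrow> a \<noteq> s \<Longrightarrow> coord l a x' = coord l a x"
    using change_coord[OF x s, of t] by metis
  have same: "coord l a x' = coord l a x" if "a < s" for a
    using x'(3)[of a] that s by simp
  have "satisfies_prefix l Y (Suc s) x'"
    unfolding satisfies_prefix_def
  proof (intro conjI allI impI)
    show "coord l 0 x' = 0" if "0 < Suc s \<and> (\<forall>y\<in>Y. coord l 0 y = 0)"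
      using that inf same[of 0] False by simp
  next
    fix a c assume a: "0 < a \<and> a < Suc s \<and> c \<le> l - a \<and> (\<forall>y\<in>Y. coord l a y = real c * coord l 0 y)"
    show "coord l a x' = real c * coord l 0 x'"
    proof (cases "a = s")
      case True
      then have "real c * coord l 0 x \<in> T"
        using a unfolding T_def by blast
      then show ?thesis
        using t x'(2) True same[of 0] False by simp
    next
      case False
      then show ?thesis
        using a mul[of a c] same[of a] same[of 0] by simp
    qed
  next
    fix a b assume a: "0 < b \<and> b < a \<and> a < Suc s \<and> (\<forall>y\<in>Y. coord l a y = coord l b y)"
    show "coord l a x' = coord l b x'"
    proof (cases "a = s")
      case True
      then have "coord l b x \<in> T"
        using a unfolding T_def by blast
      then show ?thesis
        using t x'(2) True same[of b] a by simp
    next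
      case False
      then show ?thesis
        using a eq[of b a] same[of a] same[of b] by simp
    qed
  qed
  then show ?thesis
    by (rule that[OF x'(1) _ same])
qed

lemma satisfies_prefix_lift:
  assumes "r \<le> l" "w \<in> carrier_vec (Suc l)" "satisfies_prefix l Y r w"
  obtains x where "x \<in> carrier_vec (Suc l)" "satisfies_prefix l Y l x"
    "\<And>a. a < r \<Longrightarrow> coord l a x = coord l a w"
proof -
  have "\<exists>x\<in>carrier_vec (Suc l). satisfies_prefix l Y s x \<and> (\<forall>a<r. coord l a x = coord l a w)"
    if "r \<le> s" "s \<le> l" for s
    using that
  proof (induction s rule: dec_induct)
    case base
    then show ?case using assms by blast
  next
    case (step s)
    then obtain x where x: "x \<in> carrier_vec (Suc l)" "satisfies_prefix l Y s x"
      "\<forall>a<r. coord l a x = coord l a w" by auto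
    obtain x' where "x' \<in> carrier_vec (Suc l)" "satisfies_prefix l Y (Suc s) x'"
      "\<And>a. a < s \<Longrightarrow> coord l a x' = coord l a x"
      by (rule satisfies_prefix_Suc[OF _ x(1,2)]) (use step in auto)
    then show ?case
      using x(3) step by (intro bexI[of _ x']) auto
  qed
  then show ?thesis
    using that assms(1) by blast
qed

lemma ish_cone:
  assumes "2 \<le> l"
  shows "cone_arrangement l (shi_ish l l) =
    insert {x \<in> carrier_vec (Suc l). coord l 0 x = 0}
     ({{x \<in> carrier_vec (Suc l). coord l a x = real c * coord l 0 x} | a c. 0 < a \<and> a < l \<and> c \<le> l - a} \<union>
      {{x \<in> carrier_vec (Suc l). coord l a x = coord l b x} | a b. 0 < b \<and> b < a \<and> a < l})"
    (is "_ = insert ?I (?M \<union> ?E)")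
proof -
  have M: "cone_hyperplane l (0, l - a, c) = {x \<in> carrier_vec (Suc l). coord l a x = real c * coord l 0 x}"
    if "0 < a" for a c
    using that by (auto simp: cone_hyperplane_def coord_def)
  have E: "cone_hyperplane l (l - a, l - b, 0) = {x \<in> carrier_vec (Suc l). coord l a x = coord l b x}"
    if "0 < a" "0 < b" for a b
    using that by (auto simp: cone_hyperplane_def coord_def)
  have "cone_hyperplane l ` shi_ish_index l l = ?M \<union> ?E"
  proof (intro equalityI subsetI)
    fix H assume "H \<in> cone_hyperplane l ` shi_ish_index l l"
    then obtain i j c where H: "H = cone_hyperplane l (i, j, c)" and t: "(i, j, c) \<in> shi_ish_index l l"
      by auto
    then have ij: "i < j" "j < l" "i = 0 \<and> c \<le> j \<or> 0 < i \<and> c = 0"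
      by (auto simp: shi_ish_index_def)
    from ij(3) show "H \<in> ?M \<union> ?E"
    proof (elim disjE)
      assume "i = 0 \<and> c \<le> j"
      then have "H = {x \<in> carrier_vec (Suc l). coord l (l - j) x = real c * coord l 0 x} \<and>
          0 < l - j \<and> l - j < l \<and> c \<le> l - (l - j)"
        using M[of "l - j" c] H ij by simp
      then show ?thesis by blast
    next
      assume "0 < i \<and> c = 0"
      then have "H = {x \<in> carrier_vec (Suc l). coord l (l - i) x = coord l (l - j) x} \<and>
          0 < l - j \<and> l - j < l - i \<and> l - i < l"
        using E[of "l - i" "l - j"] H ij by simp
      then show ?thesis by blast
    qed
  next
    fix H assume "H \<in> ?M \<union> ?E"
    then show "H \<in> cone_hyperplane l ` shi_ish_index l l"
    proof
      assume "H \<in> ?M"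
      then obtain a c where "H = cone_hyperplane l (0, l - a, c)" "0 < a" "a < l" "c \<le> l - a"
        using M by auto
      moreover from this have "(0, l - a, c) \<in> shi_ish_index l l"
        by (auto simp: shi_ish_index_def)
      ultimately show ?thesis by blast
    next
      assume "H \<in> ?E"
      then obtain a b where "H = cone_hyperplane l (l - a, l - b, 0)" "0 < b" "b < a" "a < l"
        using E by auto
      moreover from this have "(l - a, l - b, 0) \<in> shi_ish_index l l"
        by (auto simp: shi_ish_index_def)
      ultimately show ?thesis by blast
    qed
  qed
  moreover have "infinity_hyperplane l = ?I"
    by (auto simp: infinity_hyperplane_def coord_def)
  ultimately show ?thesis
    using cone_shi_ish[OF assms, of l] by simp
qed

text \<open>The sum of \<open>flag l r\<close> and Y consists of the vectors satisfying those
  equations of Y that involve only the first r coordinates, which is again a flat: by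
  \<open>satisfies_prefix_lift\<close> such a vector can be corrected in the later coordinates so as
  to lie in Y.\<close>

lemma ish_supersolvable:
  assumes l: "2 \<le> l"
  shows "supersolvable (Suc l) (cone_arrangement l (shi_ish l l))"
proof -
  let ?V = "carrier_vec (Suc l) :: real vec set"
  let ?A = "cone_arrangement l (shi_ish l l)"
  let ?L = "intersection_lattice (Suc l) ?A"
  let ?C = "flag l ` {..l}"
  have lin: "linear_set (Suc l) X" if "X \<in> ?L" for X
    by (rule linear_set_lattice[OF linear_set_cone[OF _ l] that])
  have AI: "{x \<in> ?V. coord l 0 x = 0} \<in> ?A"
    unfolding ish_cone[OF l] by simp
  have AM: "{x \<in> ?V. coord l a x = real c * coord l 0 x} \<in> ?A" if "0 < a" "a < l" "c \<le> l - a" for a c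
    unfolding ish_cone[OF l] using that by blast
  have AE: "{x \<in> ?V. coord l a x = coord l b x} \<in> ?A" if "0 < b" "b < a" "a < l" for a b
    unfolding ish_cone[OF l] using that by blast
  have flag_Suc: "flag l (Suc r) = {x \<in> flag l r. coord l r x = 0}" for r
    by (auto simp: flag_def less_Suc_eq)
  have flag_L: "flag l r \<in> ?L" if "r \<le> l" for r
    using that
  proof (induction r)
    case 0
    then show ?case using lattice_carrier by (simp add: flag_def)
  next
    case (Suc r)
    let ?H = "if r = 0 then {x \<in> ?V. coord l 0 x = 0} else {x \<in> ?V. coord l r x = real 0 * coord l 0 x}"
    have "?H \<in> ?A"
      unfolding if_distrib[of "\<lambda>H. H \<in> ?A"] using AI AM[of r 0] Suc.prems by (auto simp del: of_nat_0)
    then have "flag l r \<inter> ?H \<in> ?L"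
      by (rule lattice_Int[rotated]) (use Suc in simp)
    also have "flag l r \<inter> ?H = flag l (Suc r)"
      by (auto simp: flag_def less_Suc_eq)
    finally show ?case .
  qed
  have anti: "flag l s \<subseteq> flag l r" if "r \<le> s" for r s
    using that by (auto simp: flag_def)
  have last: "flag l l \<subseteq> X" if "X \<in> ?L" for X
  proof -
    have "flag l l \<subseteq> H" if "H \<in> ?A" for H
      using that l unfolding ish_cone[OF l] by (auto simp: flag_def)
    then show ?thesis
      using that unfolding intersection_lattice_def by (auto simp: flag_def)
  qed
  \<comment> \<open>Consecutive flags differ by one dimension, so nothing fits strictly between
    them; this gives maximality of the chain.\<close>
  have between: "X \<in> ?C" if X: "X \<in> ?L" and comp: "\<And>r. r \<le> l \<Longrightarrow> X \<subseteq> flag l r \<or> flag l r \<subseteq> X" for X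
  proof -
    define r where "r = (GREATEST r. r \<le> l \<and> X \<subseteq> flag l r)"
    have "0 \<le> l \<and> X \<subseteq> flag l 0"
      using lin[OF X] by (simp add: flag_def linear_set_def)
    then have r: "r \<le> l" "X \<subseteq> flag l r" and greatest: "\<And>s. s \<le> l \<Longrightarrow> X \<subseteq> flag l s \<Longrightarrow> s \<le> r"
      unfolding r_def
      using GreatestI_nat[of "\<lambda>r. r \<le> l \<and> X \<subseteq> flag l r" 0 l] Greatest_le_nat[of "\<lambda>r. r \<le> l \<and> X \<subseteq> flag l r" _ l]
      by auto
    have "flag l r \<subseteq> X"
    proof (cases "r = l")
      case True
      then show ?thesis using last[OF X] by simp
    next
      case False
      then have "Suc r \<le> l" using r by simp
      then have not: "\<not> X \<subseteq> flag l (Suc r)" and sub: "flag l (Suc r) \<subseteq> X"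
        using greatest[of "Suc r"] comp[of "Suc r"] by auto
      then obtain u where u: "u \<in> X" "u \<in> flag l r" "coord l r u \<noteq> 0"
        using r unfolding flag_Suc by auto
      show ?thesis
      proof
        fix x assume x: "x \<in> flag l r"
        define c where "c = coord l r x / coord l r u"
        have carr: "x \<in> ?V" "u \<in> ?V"
          using x u(2) by (auto simp: flag_def)
        then have "x - c \<cdot>\<^sub>v u \<in> flag l (Suc r)"
          using x u unfolding flag_Suc
          by (auto simp: flag_def coord_minus coord_smult c_def)
        then have "(x - c \<cdot>\<^sub>v u) - (- c) \<cdot>\<^sub>v u \<in> X"
          using linear_set_diff[OF lin[OF X]] sub u(1) by blast
        also have "(x - c \<cdot>\<^sub>v u) - (- c) \<cdot>\<^sub>v u = x"
          using carr by (intro eq_vecI) auto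
        finally show "x \<in> X" .
      qed
    qed
    then show ?thesis
      using r by (intro image_eqI[of _ _ r]) auto
  qed
  have "pred_on.maxchain ?L (\<lambda>X Y. Y \<subset> X) ?C"
    unfolding pred_on.maxchain_def
  proof (intro conjI notI)
    show "pred_on.chain ?L (\<lambda>X Y. Y \<subset> X) ?C"
      unfolding pred_on.chain_def
    proof (intro conjI ballI)
      show "?C \<subseteq> ?L" using flag_L by auto
      fix X Y assume "X \<in> ?C" "Y \<in> ?C"
      then obtain r s where "X = flag l r" "Y = flag l s" by auto
      then have "X \<subseteq> Y \<or> Y \<subseteq> X" using anti by (meson nat_le_linear)
      then show "(\<lambda>X Y. Y \<subset> X)\<^sup>=\<^sup>= X Y \<or> (\<lambda>X Y. Y \<subset> X)\<^sup>=\<^sup>= Y X" by auto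
    qed
    assume "\<exists>S. pred_on.chain ?L (\<lambda>X Y. Y \<subset> X) S \<and> ?C \<subset> S"
    then obtain S X where S: "pred_on.chain ?L (\<lambda>X Y. Y \<subset> X) S" "?C \<subset> S" and X: "X \<in> S" "X \<notin> ?C"
      by blast
    have "X \<subseteq> flag l r \<or> flag l r \<subseteq> X" if "r \<le> l" for r
      using S X that unfolding pred_on.chain_def by blast
    then show False
      using between[of X] S X unfolding pred_on.chain_def by blast
  qed
  moreover have "modular_element (Suc l) ?A (flag l r)" if r: "r \<le> l" for r
    unfolding modular_element_def
  proof (intro conjI ballI flag_L r)
    fix Y assume Y: "Y \<in> ?L"
    define P where "P = {x \<in> ?V. satisfies_prefix l Y r x}"
    have carrY: "Y \<subseteq> ?V"
      using lin[OF Y] by (simp add: linear_set_def)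
    have "P \<in> ?L"
    proof -
      let ?B = "{H. 0 < r \<and> H = {x \<in> ?V. coord l 0 x = 0} \<and> (\<forall>y\<in>Y. coord l 0 y = 0)} \<union>
        {{x \<in> ?V. coord l a x = real c * coord l 0 x} | a c.
           0 < a \<and> a < r \<and> c \<le> l - a \<and> (\<forall>y\<in>Y. coord l a y = real c * coord l 0 y)} \<union>
        {{x \<in> ?V. coord l a x = coord l b x} | a b.
           0 < b \<and> b < a \<and> a < r \<and> (\<forall>y\<in>Y. coord l a y = coord l b y)}"
      have "P = ?V \<inter> \<Inter>?B"
      proof (intro equalityI subsetI)
        fix x assume "x \<in> P"
        then show "x \<in> ?V \<inter> \<Inter>?B"
          unfolding P_def satisfies_prefix_def by blast
      next
        fix x assume x: "x \<in> ?V \<inter> \<Inter>?B"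
        then have "x \<in> H" if "H \<in> ?B" for H
          using that by blast
        then show "x \<in> P"
          using x unfolding P_def satisfies_prefix_def by blast
      qed
      moreover have "?B \<subseteq> ?A"
        using AI AM AE r by (auto dest: less_le_trans)
      ultimately show ?thesis
        unfolding intersection_lattice_def by blast
    qed
    moreover have "{x + y | x y. x \<in> flag l r \<and> y \<in> Y} = P"
    proof (intro equalityI subsetI)
      fix w assume "w \<in> {x + y | x y. x \<in> flag l r \<and> y \<in> Y}"
      then obtain x y where w: "w = x + y" and x: "x \<in> flag l r" and y: "y \<in> Y" by blast
      have carr: "x \<in> ?V" "y \<in> ?V"
        using x y carrY by (auto simp: flag_def)
      have "coord l a w = coord l a y" if "a < r" for a
        using x that carr unfolding w by (simp add: coord_add flag_def)
      then show "w \<in> P"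
        using carr y by (auto simp: P_def satisfies_prefix_def w)
    next
      fix w assume "w \<in> P"
      then have w: "w \<in> ?V" "satisfies_prefix l Y r w"
        by (auto simp: P_def)
      then obtain x where x: "x \<in> ?V" "satisfies_prefix l Y l x" "\<And>a. a < r \<Longrightarrow> coord l a x = coord l a w"
        using satisfies_prefix_lift[OF r] by blast
      have "x \<in> H" if H: "H \<in> ?A" "Y \<subseteq> H" for H
      proof -
        consider "H = {x \<in> ?V. coord l 0 x = 0}"
          | a c where "0 < a" "a < l" "c \<le> l - a" "H = {x \<in> ?V. coord l a x = real c * coord l 0 x}"
          | a b where "0 < b" "b < a" "a < l" "H = {x \<in> ?V. coord l a x = coord l b x}"
          using H(1) unfolding ish_cone[OF l] by blast
        then show ?thesis
        proof cases
          case 1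
          then have "\<forall>y\<in>Y. coord l 0 y = 0" using H(2) by auto
          then show ?thesis using 1 x l by (simp add: satisfies_prefix_def)
        next
          case 2
          then have "\<forall>y\<in>Y. coord l a y = real c * coord l 0 y" using H(2) by auto
          then show ?thesis using 2 x unfolding satisfies_prefix_def by blast
        next
          case 3
          then have "\<forall>y\<in>Y. coord l a y = coord l b y" using H(2) by auto
          then show ?thesis using 3 x unfolding satisfies_prefix_def by blast
        qed
      qed
      then have "x \<in> Y"
        using lattice_eq_closure[OF Y] x(1) by blast
      moreover have "w - x \<in> flag l r"
        using w(1) x by (simp add: flag_def coord_minus)
      moreover have "w = (w - x) + x"
        using w(1) x(1) by (intro eq_vecI) auto
      ultimately show "w \<in> {x + y | x y. x \<in> flag l r \<and> y \<in> Y}"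
        by blast
    qed
    ultimately show "{x + y | x y. x \<in> flag l r \<and> y \<in> Y} \<in> ?L"
      by simp
  qed
  ultimately show ?thesis
    unfolding supersolvable_def by (intro exI[of _ ?C]) auto
qed


section \<open>A rank-three localization without modular points\<close>

type_synonym triple = "real \<times> real \<times> real"

definition dot :: "triple \<Rightarrow> triple \<Rightarrow> real" where
  "dot = (\<lambda>(a, b, c) (p, q, r). a * p + b * q + c * r)"

text \<open>The localization at \<open>z = x\<^sub>0 - x\<^sub>k\<^sub>-\<^sub>1 = x\<^sub>0 - x\<^sub>l\<^sub>-\<^sub>1 = 0\<close> has rank 3. In the affine
  coordinates \<open>u = x\<^sub>0 - x\<^sub>k\<^sub>-\<^sub>1\<close> and \<open>v = x\<^sub>0 - x\<^sub>l\<^sub>-\<^sub>1\<close> it consists of the lines \<open>u = c\<close>, \<open>v = c\<close> for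
  \<open>c < k\<close>, of \<open>u = v\<close>, of \<open>v = u + 1\<close>, and of the line at infinity.\<close>

definition local_proj :: "nat \<Rightarrow> nat \<Rightarrow> real vec \<Rightarrow> triple" where
  "local_proj l k x = (x $ l, x $ 0 - x $ (k - 1), x $ 0 - x $ (l - 1))"

definition local_forms :: "nat \<Rightarrow> triple set" where
  "local_forms k = {(1, 0, 0), (0, 1, -1), (1, 1, -1)} \<union>
     {(- real c, 1, 0) | c. c < k} \<union> {(- real c, 0, 1) | c. c < k}"

definition local_hyperplane :: "nat \<Rightarrow> nat \<Rightarrow> triple \<Rightarrow> real vec set" where
  "local_hyperplane l k a = {x \<in> carrier_vec (Suc l). dot a (local_proj l k x) = 0}"

lemma dot_linear:
  assumes "x \<in> carrier_vec (Suc l)" "y \<in> carrier_vec (Suc l)" "0 < k" "k \<le> l"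
  shows "dot a (local_proj l k (x + y)) = dot a (local_proj l k x) + dot a (local_proj l k y)"
    "dot a (local_proj l k (x - y)) = dot a (local_proj l k x) - dot a (local_proj l k y)"
    "dot a (local_proj l k (c \<cdot>\<^sub>v x)) = c * dot a (local_proj l k x)"
  using assms by (cases a; auto simp: dot_def local_proj_def algebra_simps)+

lemma local_proj_surj:
  assumes "2 \<le> k" "k < l"
  obtains x where "x \<in> carrier_vec (Suc l)" "local_proj l k x = w"
proof -
  obtain p q r where w: "w = (p, q, r)" by (cases w)
  show ?thesis
    by (rule that[of "vec (Suc l) (\<lambda>i. if i = l then p else if i = k - 1 then - q else if i = l - 1 then - r else 0)"])
       (use assms in \<open>auto simp: local_proj_def w\<close>)
qed

lemma local_hyperplane_in_cone:
  assumes "2 \<le> k" "k < l" "a \<in> local_forms k"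
  shows "local_hyperplane l k a \<in> cone_arrangement l (shi_ish l k)"
proof -
  consider "a = (1, 0, 0)" | "a = (0, 1, -1)" | "a = (1, 1, -1)"
    | c where "c < k" "a = (- real c, 1, 0)" | c where "c < k" "a = (- real c, 0, 1)"
    using assms(3) unfolding local_forms_def by blast
  then have "local_hyperplane l k a = infinity_hyperplane l \<or>
      (\<exists>t\<in>shi_ish_index l k. local_hyperplane l k a = cone_hyperplane l t)"
  proof cases
    case 1
    then show ?thesis
      by (auto simp: local_hyperplane_def infinity_hyperplane_def dot_def local_proj_def)
  next
    case 2
    then have "local_hyperplane l k a = cone_hyperplane l (k - 1, l - 1, 0)"
      by (auto simp: local_hyperplane_def cone_hyperplane_def dot_def local_proj_def)
    moreover have "(k - 1, l - 1, 0) \<in> shi_ish_index l k"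
      using assms by (auto simp: shi_ish_index_def)
    ultimately show ?thesis by blast
  next
    case 3
    then have "local_hyperplane l k a = cone_hyperplane l (k - 1, l - 1, 1)"
      by (auto simp: local_hyperplane_def cone_hyperplane_def dot_def local_proj_def)
    moreover have "(k - 1, l - 1, 1) \<in> shi_ish_index l k"
      using assms by (auto simp: shi_ish_index_def)
    ultimately show ?thesis by blast
  next
    case (4 c)
    then have "local_hyperplane l k a = cone_hyperplane l (0, k - 1, c)"
      by (auto simp: local_hyperplane_def cone_hyperplane_def dot_def local_proj_def)
    moreover have "(0, k - 1, c) \<in> shi_ish_index l k"
      using assms 4 by (auto simp: shi_ish_index_def)
    ultimately show ?thesis by blast
  next
    case (5 c)
    then have "local_hyperplane l k a = cone_hyperplane l (0, l - 1, c)"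
      by (auto simp: local_hyperplane_def cone_hyperplane_def dot_def local_proj_def)
    moreover have "(0, l - 1, c) \<in> shi_ish_index l k"
      using assms 5 by (auto simp: shi_ish_index_def)
    ultimately show ?thesis by blast
  qed
  then show ?thesis
    unfolding cone_shi_ish[OF assms(1)] by blast
qed

lemma cone_imp_local_hyperplane:
  assumes kl: "2 \<le> k" "k < l" and H: "H \<in> cone_arrangement l (shi_ish l k)"
    and sub: "{x \<in> carrier_vec (Suc l). local_proj l k x = (0, 0, 0)} \<subseteq> H"
  obtains a where "a \<in> local_forms k" "H = local_hyperplane l k a"
proof -
  consider "H = infinity_hyperplane l"
    | i j c where "(i, j, c) \<in> shi_ish_index l k" "H = cone_hyperplane l (i, j, c)"
    using H unfolding cone_shi_ish[OF kl(1)] by auto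
  then show ?thesis
  proof cases
    case 1
    then show ?thesis
      by (intro that[of "(1, 0, 0)"])
         (auto simp: local_forms_def local_hyperplane_def infinity_hyperplane_def dot_def local_proj_def)
  next
    case 2
    have ij: "i < j" "j < l" "c = 0 \<or> i = 0 \<and> c \<le> j \<and> c < k \<or> c = 1 \<and> k \<le> Suc i"
      using 2(1) by (auto simp: shi_ish_index_def)
    \<comment> \<open>a point of the flat whose coordinates are otherwise pairwise distinct\<close>
    let ?e = "vec (Suc l) (\<lambda>p. if p \<in> {0, k - 1, l - 1, l} then 0 else real p)"
    have "?e \<in> H"
      by (rule subsetD[OF sub]) (use kl in \<open>auto simp: local_proj_def\<close>)
    then have "?e $ i = ?e $ j"
      using 2(2) by (simp add: cone_hyperplane_def)
    then have mem: "i \<in> {0, k - 1, l - 1}" "j \<in> {0, k - 1, l - 1}"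
      using ij kl by (auto split: if_splits)
    consider "i = 0" "j = k - 1" "c < k" | "i = 0" "j = l - 1" "c < k" | "i = k - 1" "j = l - 1" "c = 0"
      | "i = k - 1" "j = l - 1" "c = 1"
      using mem ij kl by (elim disjE) auto
    then show ?thesis
    proof cases
      case 1
      then show ?thesis
        using 2(2) by (intro that[of "(- real c, 1, 0)"])
          (auto simp: local_forms_def local_hyperplane_def cone_hyperplane_def dot_def local_proj_def)
    next
      case 2
      then show ?thesis
        using \<open>H = cone_hyperplane l (i, j, c)\<close> by (intro that[of "(- real c, 0, 1)"])
          (auto simp: local_forms_def local_hyperplane_def cone_hyperplane_def dot_def local_proj_def)
    next
      case 3
      then show ?thesis
        using 2(2) by (intro that[of "(0, 1, -1)"])
          (auto simp: local_forms_def local_hyperplane_def cone_hyperplane_def dot_def local_proj_def)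
    next
      case 4
      then show ?thesis
        using 2(2) by (intro that[of "(1, 1, -1)"])
          (auto simp: local_forms_def local_hyperplane_def cone_hyperplane_def dot_def local_proj_def)
    qed
  qed
qed

text \<open>The leading entry 1 makes the point affine, which excludes the line at infinity.\<close>

lemma local_forms_cases:
  assumes "\<exists>a\<in>local_forms k. dot a (1, p, q) = 0 \<and> dot a (z, u, v) = 0"
  shows "(\<exists>c<k. p = real c \<and> u = real c * z) \<or> (\<exists>c<k. q = real c \<and> v = real c * z) \<or>
    p = q \<and> u = v \<or> q = p + 1 \<and> v = u + z"
  using assms unfolding local_forms_def dot_def by auto

text \<open>The hypothesis says that (z, u, v) is joined by a line of the arrangement to every
  affine point in which two of its lines meet, as a modular point would be. Six such points already
  force all three coordinates to vanish.\<close>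

lemma no_modular_point:
  assumes k: "2 \<le> k"
    and w: "\<And>p q a b. a \<in> local_forms k \<Longrightarrow> b \<in> local_forms k \<Longrightarrow>
      dot a (1, p, q) = 0 \<Longrightarrow> dot b (1, p, q) = 0 \<Longrightarrow>
      (\<And>x. dot a x = 0 \<Longrightarrow> dot b x = 0 \<Longrightarrow> \<exists>t. x = (t, t * p, t * q)) \<Longrightarrow>
      \<exists>c\<in>local_forms k. dot c (1, p, q) = 0 \<and> dot c (z, u, v) = 0"
  shows "z = 0 \<and> u = 0 \<and> v = 0"
proof -
  define K where "K = real (k - 1)"
  have K: "1 \<le> K" "real k = K + 1"
    using k by (auto simp: K_def)
  have form_u: "(- real c, 1, 0) \<in> local_forms k" if "c < k" for c
    using that by (auto simp: local_forms_def)
  have form_v: "(- real c, 0, 1) \<in> local_forms k" if "c < k" for c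
    using that by (auto simp: local_forms_def)
  have form_d: "(1, 1, -1) \<in> local_forms k"
    by (auto simp: local_forms_def)
  have grid: "\<exists>c\<in>local_forms k. dot c (1, real i, real j) = 0 \<and> dot c (z, u, v) = 0"
    if "i < k" "j < k" for i j
    by (rule w[OF form_u[OF that(1)] form_v[OF that(2)]]) (auto simp: dot_def)
  have lt: "k - 1 < k" "0 < k" "1 < k"
    using k by auto
  \<comment> \<open>The lines v = 0 and v = u + 1 meet at (-1, 0), which lies on no line u = c since
    c is natural.\<close>
  have A: "v = 0 \<or> v = u + z"
  proof -
    have "\<exists>c\<in>local_forms k. dot c (1, -1, 0) = 0 \<and> dot c (z, u, v) = 0"
      by (rule w[OF form_v[of 0] form_d]) (use k in \<open>auto simp: dot_def\<close>)
    from local_forms_cases[OF this] show ?thesis by auto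
  qed
  \<comment> \<open>The point (K, K + 1) lies on no line v = c, because K + 1 = k and c < k.\<close>
  have B: "u = K * z \<or> v = u + z"
  proof -
    have "\<exists>c\<in>local_forms k. dot c (1, K, K + 1) = 0 \<and> dot c (z, u, v) = 0"
      by (rule w[OF form_u[of "k - 1"] form_d]) (use k in \<open>auto simp: dot_def K_def algebra_simps\<close>)
    from local_forms_cases[OF this] show ?thesis using K by auto
  qed
  have C: "u = K * z \<or> v = 0"
    using local_forms_cases[OF grid[OF lt(1,2), folded K_def]] K by auto
  have D: "u = K * z \<or> v = K * z \<or> u = v"
    using local_forms_cases[OF grid[OF lt(1,1), folded K_def]] by auto
  have E: "u = 0 \<or> v = 0 \<or> u = v"
    using local_forms_cases[OF grid[OF lt(2,2)]] by auto
  have F: "u = 0 \<or> v = z \<or> v = u + z"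
    using local_forms_cases[OF grid[OF lt(2,3)]] by auto
  have "z = 0"
  proof (rule ccontr)
    assume z: "z \<noteq> 0"
    \<comment> \<open>Naming the product K z makes the remaining case analysis linear.\<close>
    define m where "m = K * z"
    have "(K + 1) * z \<noteq> 0" "m \<noteq> 0"
      using K z by (auto simp: m_def)
    then have "m + z \<noteq> 0"
      by (simp add: m_def distrib_right)
    then show False
      using A B C D E F z \<open>m \<noteq> 0\<close> unfolding m_def[symmetric] by argo
  qed
  then show ?thesis
    using A B C D E F by auto
qed

definition cross :: "triple \<Rightarrow> triple \<Rightarrow> triple" where
  "cross = (\<lambda>(a, b, c) (p, q, r). (b * r - c * q, c * p - a * r, a * q - b * p))"

lemma cross_zero_imp_multiple:
  assumes "cross w x = (0, 0, 0)" "w = (a, b, c)" "w \<noteq> (0, 0, 0)"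
  obtains t where "x = (t * a, t * b, t * c)"
proof -
  obtain p q r where x: "x = (p, q, r)" by (cases x)
  have eq: "b * r = c * q" "c * p = a * r" "a * q = b * p"
    using assms(1) by (auto simp: cross_def x assms(2))
  consider "a \<noteq> 0" | "b \<noteq> 0" | "c \<noteq> 0"
    using assms(2,3) by auto
  then show ?thesis
  proof cases
    case 1
    then show ?thesis using eq by (intro that[of "p / a"]) (auto simp: x field_simps)
  next
    case 2
    then show ?thesis using eq by (intro that[of "q / b"]) (auto simp: x field_simps)
  next
    case 3
    then show ?thesis using eq by (intro that[of "r / c"]) (auto simp: x field_simps)
  qed
qed

text \<open>Some member X of the chain has a one-dimensional image in the three local coordinates.
  Modularity of X in the cone makes the direction of this image a modular point of the localization,
  which \<open>no_modular_point\<close> excludes.\<close>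

lemma shi_ish_not_supersolvable:
  assumes kl: "2 \<le> k" "k < l"
  shows "\<not> supersolvable (Suc l) (cone_arrangement l (shi_ish l k))"
proof
  let ?V = "carrier_vec (Suc l) :: real vec set"
  let ?A = "cone_arrangement l (shi_ish l k)"
  let ?L = "intersection_lattice (Suc l) ?A"
  let ?p = "local_proj l k"
  assume "supersolvable (Suc l) ?A"
  then obtain C where C: "pred_on.maxchain ?L (\<lambda>X Y. Y \<subset> X) C"
    and modular: "\<And>X. X \<in> C \<Longrightarrow> modular_element (Suc l) ?A X"
    unfolding supersolvable_def by blast
  have lin: "linear_set (Suc l) X" if "X \<in> ?L" for X
    by (rule linear_set_lattice[OF linear_set_cone[OF _ kl(1)] that])
  have hyp: "local_hyperplane l k a \<in> ?A" if "a \<in> local_forms k" for a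
    by (rule local_hyperplane_in_cone[OF kl that])
  have "finite ?A"
    unfolding cone_shi_ish[OF kl(1)] using card_shi_ish_index(1)[OF kl(1)] by simp
  have "?L \<subseteq> (\<lambda>B. ?V \<inter> \<Inter>B) ` Pow ?A"
    by (auto simp: intersection_lattice_def)
  then have "finite C"
    using maxchain_subset[OF C] \<open>finite ?A\<close> by (meson finite_Pow_iff finite_imageI finite_subset)
  have lin_dot: "dot a (?p (x + y)) = dot a (?p x) + dot a (?p y)"
    "dot a (?p (x - c \<cdot>\<^sub>v y)) = dot a (?p x) - c * dot a (?p y)" "dot a (?p (c \<cdot>\<^sub>v x)) = c * dot a (?p x)"
    if "x \<in> ?V" "y \<in> ?V" for a x y c
    using dot_linear[of x l y k a] dot_linear[of x l "c \<cdot>\<^sub>v y" k a] dot_linear[of y l y k a]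
      dot_linear(3)[of x l x k a] that kl by auto
  define big where "big X \<longleftrightarrow> (\<exists>x\<in>X. \<exists>y\<in>X. cross (?p x) (?p y) \<noteq> (0, 0, 0))" for X
  \<comment> \<open>Otherwise every image is zero or of dimension at least two. Cut the smallest
    member of the second kind by a local hyperplane: the section is comparable with the whole chain,
    hence a member, but its image is neither zero nor big.\<close>
  have "\<exists>X\<in>C. \<exists>x\<in>X. ?p x \<noteq> (0, 0, 0) \<and> \<not> big X"
  proof (rule ccontr)
    assume "\<not> (\<exists>X\<in>C. \<exists>x\<in>X. ?p x \<noteq> (0, 0, 0) \<and> \<not> big X)"
    then have small: "?p x = (0, 0, 0)" if "X \<in> C" "\<not> big X" "x \<in> X" for X x
      using that by blast
    have "?V \<in> C"
    proof (rule maxchain_memI[OF C lattice_carrier])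
      fix X assume "X \<in> C"
      then have "linear_set (Suc l) X"
        using lin maxchain_subset[OF C] by blast
      then show "X \<subseteq> ?V \<or> ?V \<subseteq> X"
        by (simp add: linear_set_def)
    qed
    moreover have "big ?V"
    proof -
      obtain x y where "x \<in> ?V" "?p x = (1, 0, 0)" "y \<in> ?V" "?p y = (0, 1, 0)"
        by (metis local_proj_surj[OF kl])
      moreover have "cross (1, 0, 0) (0, 1, 0) \<noteq> (0, 0, 0)"
        by (simp add: cross_def)
      ultimately show ?thesis
        unfolding big_def by metis
    qed
    ultimately have "?V \<in> {X \<in> C. big X}"
      by simp
    then obtain X where X: "X \<in> C" "big X" and minimal: "\<And>Z. Z \<in> C \<Longrightarrow> big Z \<Longrightarrow> Z \<subseteq> X \<Longrightarrow> Z = X"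
      using finite_has_minimal2[of "{X \<in> C. big X}" ?V] \<open>finite C\<close> by auto
    have least: "X \<subseteq> Z" if "Z \<in> C" "big Z" for Z
      using maxchain_comparable[OF C that(1) X(1)] minimal that by blast
    obtain x y where xy: "x \<in> X" "y \<in> X" "cross (?p x) (?p y) \<noteq> (0, 0, 0)"
      using X(2) unfolding big_def by blast
    have "X \<in> ?L"
      using X(1) maxchain_subset[OF C] by blast
    then have linX: "linear_set (Suc l) X" by (rule lin)
    have xyV: "x \<in> ?V" "y \<in> ?V"
      using linX xy by (auto simp: linear_set_def)
    have px: "?p x \<noteq> (0, 0, 0)"
      using xy(3) by (auto simp: cross_def split: prod.splits)
    obtain a where a: "a \<in> local_forms k" "dot a (?p x) \<noteq> 0"
    proof -
      have "(1, 0, 0) \<in> local_forms k" "(- real 0, 1, 0) \<in> local_forms k" "(- real 0, 0, 1) \<in> local_forms k"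
        using kl by (auto simp: local_forms_def simp del: of_nat_0 neg_equal_zero minus_zero)
      moreover obtain p q r where "?p x = (p, q, r)" by (cases "?p x")
      ultimately show ?thesis
        using px that by (force simp: dot_def)
    qed
    let ?Z = "X \<inter> local_hyperplane l k a"
    have ZC: "?Z \<in> C"
    proof (rule maxchain_memI[OF C])
      show "?Z \<in> ?L" by (rule lattice_Int[OF \<open>X \<in> ?L\<close> hyp[OF a(1)]])
      fix U assume U: "U \<in> C"
      show "U \<subseteq> ?Z \<or> ?Z \<subseteq> U"
      proof (cases "big U")
        case True
        then show ?thesis using least[OF U] by blast
      next
        case False
        then have "\<not> X \<subseteq> U"
          using X(2) unfolding big_def by blast
        then have "U \<subseteq> X"
          using maxchain_comparable[OF C U X(1)] by blast
        moreover have "u \<in> local_hyperplane l k a" if "u \<in> U" for u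
          using small[OF U False that] that \<open>U \<subseteq> X\<close> linX
          by (auto simp: local_hyperplane_def linear_set_def dot_def split: prod.splits)
        ultimately show ?thesis by blast
      qed
    qed
    have "x \<notin> ?Z"
      using a by (simp add: local_hyperplane_def)
    then have "\<not> big ?Z"
      using minimal[OF ZC] xy(1) by blast
    \<comment> \<open>The multiple for which y - c x lies on the local hyperplane; since the image
      of this difference is zero, x and y have dependent images.\<close>
    define c where "c = dot a (?p y) / dot a (?p x)"
    have "y - c \<cdot>\<^sub>v x \<in> X"
      by (rule linear_set_diff[OF linX xy(2,1)])
    moreover have "dot a (?p (y - c \<cdot>\<^sub>v x)) = 0"
      using a xyV by (simp add: lin_dot c_def)
    ultimately have "y - c \<cdot>\<^sub>v x \<in> ?Z"
      using xyV by (simp add: local_hyperplane_def)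
    then have "?p (y - c \<cdot>\<^sub>v x) = (0, 0, 0)"
      by (rule small[OF ZC \<open>\<not> big ?Z\<close>])
    then have "y $ l = c * x $ l" "y $ 0 - y $ (k - 1) = c * (x $ 0 - x $ (k - 1))"
      "y $ 0 - y $ (l - 1) = c * (x $ 0 - x $ (l - 1))"
      using xyV kl by (simp_all add: local_proj_def algebra_simps)
    then have "cross (?p x) (?p y) = (0, 0, 0)"
      by (simp add: cross_def local_proj_def)
    then show False
      using xy(3) by simp
  qed
  then obtain X x where X: "X \<in> C" "\<not> big X" and x: "x \<in> X" "?p x \<noteq> (0, 0, 0)"
    by blast
  obtain z u v where w: "?p x = (z, u, v)" by (cases "?p x")
  have line: "\<exists>t. ?p y = (t * z, t * u, t * v)" if "y \<in> X" for y
  proof -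
    have "cross (?p x) (?p y) = (0, 0, 0)"
      using X(2) x(1) that unfolding big_def by blast
    then show ?thesis
      using cross_zero_imp_multiple[OF _ w x(2)] by metis
  qed
  have mod: "{x + y | x y. x \<in> X \<and> y \<in> Y} \<in> ?L" if "Y \<in> ?L" for Y
    using modular[OF X(1)] that by (simp add: modular_element_def)
  have linX: "linear_set (Suc l) X"
    using lin X(1) maxchain_subset[OF C] by blast
  have "z = 0 \<and> u = 0 \<and> v = 0"
  proof (rule no_modular_point[OF kl(1)])
    fix p q a b
    assume ab: "a \<in> local_forms k" "b \<in> local_forms k" "dot a (1, p, q) = 0" "dot b (1, p, q) = 0"
      and span: "\<And>x. dot a x = 0 \<Longrightarrow> dot b x = 0 \<Longrightarrow> \<exists>t. x = (t, t * p, t * q)"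
    let ?Y = "?V \<inter> local_hyperplane l k a \<inter> local_hyperplane l k b"
    let ?S = "{x + y | x y. x \<in> X \<and> y \<in> ?Y}"
    have "?Y \<in> ?L"
      by (intro lattice_Int lattice_carrier hyp ab)
    then have "?S \<in> ?L" by (rule mod)
    then obtain B where B: "?S = ?V \<inter> \<Inter>B" "B \<subseteq> ?A"
      unfolding intersection_lattice_def by blast
    have zero: "0\<^sub>v (Suc l) \<in> X" "0\<^sub>v (Suc l) \<in> ?Y"
      using linX lin[OF \<open>?Y \<in> ?L\<close>] by (auto simp: linear_set_def)
    have XV: "X \<subseteq> ?V"
      using linX by (simp add: linear_set_def)
    have XS: "X \<subseteq> ?S" and YS: "?Y \<subseteq> ?S"
    proof -
      show "X \<subseteq> ?S"
      proof
        fix y assume "y \<in> X"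
        then show "y \<in> ?S"
          using zero(2) XV by (intro CollectI exI[of _ y] exI[of _ "0\<^sub>v (Suc l)"]) auto
      qed
      show "?Y \<subseteq> ?S"
      proof
        fix y assume "y \<in> ?Y"
        then show "y \<in> ?S"
          using zero(1) by (intro CollectI exI[of _ y] exI[of _ "0\<^sub>v (Suc l)"]) auto
      qed
    qed
    \<comment> \<open>The sum has an image of dimension at most two, so it is not the whole space
      and lies in some hyperplane of the arrangement.\<close>
    have "B \<noteq> {}"
    proof
      assume "B = {}"
      \<comment> \<open>A normal to both directions; when these are dependent, (-p, 1, 0) is
        one.\<close>
      obtain n where n: "n \<noteq> (0, 0, 0)" "dot n (z, u, v) = 0" "dot n (1, p, q) = 0"
      proof (cases "cross (1, p, q) (z, u, v) = (0, 0, 0)")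
        case True
        then have "u = z * p" by (simp add: cross_def)
        then show ?thesis
          by (intro that[of "(- p, 1, 0)"]) (auto simp: dot_def)
      next
        case False
        then show ?thesis
          by (intro that[of "cross (1, p, q) (z, u, v)"]) (auto simp: dot_def cross_def algebra_simps)
      qed
      obtain y where y: "y \<in> ?V" "?p y = n"
        by (rule local_proj_surj[OF kl])
      then have "y \<in> ?S"
        using B \<open>B = {}\<close> by blast
      then obtain y1 y2 where y12: "y = y1 + y2" "y1 \<in> X" "y2 \<in> ?Y" by blast
      have V: "y1 \<in> ?V" "y2 \<in> ?V"
        using y12 XV by auto
      obtain t where t: "?p y1 = (t * z, t * u, t * v)"
        using line[OF y12(2)] by blast
      obtain s where s: "?p y2 = (s, s * p, s * q)"
        using span[of "?p y2"] y12(3) by (auto simp: local_hyperplane_def)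
      have "dot n (?p y) = t * dot n (z, u, v) + s * dot n (1, p, q)"
        unfolding y12(1) lin_dot(1)[OF V] t s by (cases n) (simp add: dot_def algebra_simps)
      then have "dot n n = 0"
        using n y by simp
      then show False
        using n(1) by (cases n) (auto simp: dot_def add_nonneg_eq_0_iff)
    qed
    then obtain H where H: "H \<in> B" by blast
    then have SH: "?S \<subseteq> H" and HA: "H \<in> ?A"
      using B by blast+
    \<comment> \<open>The hyperplane \<open>H\<close> contains the flat at which the arrangement is
      localized, so it is one of the local ones.\<close>
    have "{x \<in> ?V. ?p x = (0, 0, 0)} \<subseteq> ?Y"
      by (cases a; cases b) (auto simp: local_hyperplane_def dot_def)
    then have "{x \<in> ?V. ?p x = (0, 0, 0)} \<subseteq> H"
      using YS SH by blast
    then obtain c where c: "c \<in> local_forms k" "H = local_hyperplane l k c"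
      by (rule cone_imp_local_hyperplane[OF kl HA])
    obtain y where y: "y \<in> ?V" "?p y = (1, p, q)"
      by (rule local_proj_surj[OF kl])
    then have "y \<in> ?Y"
      using ab by (simp add: local_hyperplane_def)
    then have "y \<in> H" "x \<in> H"
      using XS YS SH x(1) by blast+
    then have "dot c (1, p, q) = 0" "dot c (z, u, v) = 0"
      using c(2) y w by (auto simp: local_hyperplane_def)
    then show "\<exists>c\<in>local_forms k. dot c (1, p, q) = 0 \<and> dot c (z, u, v) = 0"
      using c(1) by blast
  qed
  then show False
    using x(2) w by simp
qed


theorem theorem1p6:
  fixes l k :: nat
  assumes "2 \<le> l" and "2 \<le> k" and "k \<le> l"
  shows "free_with_exponents (l + 1) (cone_arrangement l (shi_ish l k)) ({#0, 1#} + replicate_mset (l - 1) l)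
    \<and> (3 \<le> l \<longrightarrow> (supersolvable (l + 1) (cone_arrangement l (shi_ish l k)) \<longleftrightarrow> k = l))"
proof -
  have "supersolvable (l + 1) (cone_arrangement l (shi_ish l k)) \<longleftrightarrow> k = l"
    using ish_supersolvable[OF assms(1)] shi_ish_not_supersolvable[OF assms(2), of l] assms(3)
    by (cases "k = l") auto
  then show ?thesis
    using free_cone_shi_ish[OF assms(2,3)] by simp
qed

end
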